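(* Let $M$ be an oriented Riemannian $4$-manifold and let $h$ be a smooth $2$-form on $M$ with $dh=0$ and $d^*h=0$. On a neighborhood $U$ of a point where $h$ is neither self-dual nor anti-self-dual, let $\{e_i\}_{i=1}^4$ be a smooth oriented local orthonormal frame with dual coframe $\{w^i\}_{i=1}^4$ such that $$h=a\,w^1\wedge w^2+b\,w^3\wedge w^4,\qquad a>|b|.$$ Let $f=\ln\big(\sqrt{a^2-b^2}\big)$. Then at every critical point of $f$ in $U$, $$-\Delta f=R_{1331}+R_{2332}+R_{1441}+R_{2442}+|II_a|^2+|II_b|^2-\tfrac12|T_a|^2-\tfrac12|T_b|^2 .$$
   Context: $\Delta$ is the nonnegative Laplacian, so $-\Delta f$ is the trace of the Hessian of $f$. $R_{ijji}$ denotes the sectional curvature of the plane spanned by $e_i,e_j$ (positive on round spheres). Write $\nabla_{e_i}e_j=\gamma_{ij}^k e_k$ (summation over $k$) for the Levi-Civita connection and $c_{ij}^k:=\gamma_{ij}^k-\gamma_{ji}^k$. The torsion vectors are $$T_a:=c^3_{12}e_3+c^4_{12}e_4,\qquad T_b:=c^1_{34}e_1+c^2_{34}e_2 .$$ The generalized second fundamental forms of the distributions spanned by $\{e_1,e_2\}$ and $\{e_3,e_4\}$ are $$II_a:=\sum_{i,j\in\{1,2\}}\sum_{m\in\{3,4\}}\tfrac12(\gamma^m_{ij}+\gamma^m_{ji})\,w^i\otimes w^j\otimes e_m,\qquad II_b:=\sum_{i,j\in\{3,4\}}\sum_{m\in\{1,2\}}\tfrac12(\gamma^m_{ij}+\gamma^m_{ji})\,w^i\otimes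 w^j\otimes e_m ,$$ with the norms induced by the metric. (Up to an additive constant $f$ equals $\tfrac14\ln(|h_+|^2|h_-|^2)$, where $h_\pm$ are the self-dual and anti-self-dual parts of $h$.) *)

theory Defs
  imports "HOL-Analysis.Analysis"
begin

section \<open>Smooth functions on open sets of a Euclidean space\<close>

primrec Ck_on :: "nat \<Rightarrow> 'a::real_normed_vector set \<Rightarrow> ('a \<Rightarrow> 'b::real_normed_vector) \<Rightarrow> bool" where
  "Ck_on 0 S f \<longleftrightarrow> continuous_on S f"
| "Ck_on (Suc k) S f \<longleftrightarrow> (\<forall>x\<in>S. f differentiable (at x)) \<and>
     (\<forall>v. Ck_on k S (\<lambda>x. frechet_derivative f (at x) v))"

definition smooth_on :: "'a::real_normed_vector set \<Rightarrow> ('a \<Rightarrow> 'b::real_normed_vector) \<Rightarrow> bool" where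
  "smooth_on S f \<longleftrightarrow> (\<forall>k. Ck_on k S f)"

section \<open>Oriented smooth manifolds\<close>

text \<open>The manifold is the whole type \<open>'m\<close> (Hausdorff and second countable through its type class),
  with a smooth atlas whose transition maps have positive Jacobian determinant.  A chart is a pair
  of its domain and its coordinate map; the map is only relevant on the domain.  The atlas need not
  be maximal.\<close>

type_synonym ('m, 'n) atlas = "('m set \<times> ('m \<Rightarrow> real ^ 'n)) set"

definition chart :: "'m::topological_space set \<Rightarrow> ('m \<Rightarrow> real ^ 'n) \<Rightarrow> bool" where
  "chart D \<phi> \<longleftrightarrow> open D \<and> open (\<phi> ` D) \<and> homeomorphism D (\<phi> ` D) \<phi> (inv_into D \<phi>)"

definition oriented_atlas ::
  "('m::{t2_space, second_countable_topology}, 'n::finite) atlas \<Rightarrow> bool" where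
  "oriented_atlas A \<longleftrightarrow>
     (\<forall>(D, \<phi>)\<in>A. chart D \<phi>) \<and> (\<Union>(D, \<phi>)\<in>A. D) = UNIV \<and>
     (\<forall>(D, \<phi>)\<in>A. \<forall>(D', \<phi>')\<in>A.
        smooth_on (\<phi> ` (D \<inter> D')) (\<phi>' \<circ> inv_into D \<phi>) \<and>
        (\<forall>x\<in>\<phi> ` (D \<inter> D'). 0 < det (jacobian (\<phi>' \<circ> inv_into D \<phi>) (at x))))"

definition smooth_fun_on ::
  "('m::topological_space, 'n::finite) atlas \<Rightarrow> 'm set \<Rightarrow> ('m \<Rightarrow> real) \<Rightarrow> bool" where
  "smooth_fun_on A V f \<longleftrightarrow> open V \<and>
     (\<forall>(D, \<phi>)\<in>A. smooth_on (\<phi> ` (D \<inter> V)) (f \<circ> inv_into D \<phi>))"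

definition smooth_near ::
  "('m::topological_space, 'n::finite) atlas \<Rightarrow> 'm \<Rightarrow> ('m \<Rightarrow> real) \<Rightarrow> bool" where
  "smooth_near A p f \<longleftrightarrow> (\<exists>V. p \<in> V \<and> smooth_fun_on A V f)"

section \<open>Tangent vectors and vector fields\<close>

text \<open>A tangent vector at \<open>p\<close> is a derivation at \<open>p\<close> of the functions that are smooth near \<open>p\<close>.
  Such a derivation depends only on the germ at \<open>p\<close>.  On the remaining functions it is set to 0, so
  that equality of tangent vectors is equality in HOL.  Linear combinations are pointwise.\<close>

type_synonym 'm tangent = "('m \<Rightarrow> real) \<Rightarrow> real"
type_synonym 'm vfield = "'m \<Rightarrow> 'm tangent"

definition tangent_space ::
  "('m::topological_space, 'n::finite) atlas \<Rightarrow> 'm \<Rightarrow> 'm tangent set" where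
  "tangent_space A p = {v.
     (\<forall>f. \<not> smooth_near A p f \<longrightarrow> v f = 0) \<and>
     (\<forall>f k. smooth_near A p f \<longrightarrow> smooth_near A p k \<longrightarrow>
        v (\<lambda>q. f q + k q) = v f + v k \<and>
        v (\<lambda>q. f q * k q) = f p * v k + k p * v f) \<and>
     (\<forall>f c. smooth_near A p f \<longrightarrow> v (\<lambda>q. c * f q) = c * v f)}"

definition vector_field ::
  "('m::topological_space, 'n::finite) atlas \<Rightarrow> 'm set \<Rightarrow> 'm vfield \<Rightarrow> bool" where
  "vector_field A U X \<longleftrightarrow> open U \<and> (\<forall>p\<in>U. X p \<in> tangent_space A p) \<and>
     (\<forall>V f. V \<subseteq> U \<longrightarrow> smooth_fun_on A V f \<longrightarrow> smooth_fun_on A V (\<lambda>p. X p f))"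

text \<open>\<open>X\<close> is a smooth vector field on a neighbourhood of \<open>p\<close> with value \<open>u\<close> at \<open>p\<close>.\<close>

definition extends ::
  "('m::topological_space, 'n::finite) atlas \<Rightarrow> 'm \<Rightarrow> 'm tangent \<Rightarrow> 'm vfield \<Rightarrow> bool" where
  "extends A p u X \<longleftrightarrow> X p = u \<and> (\<exists>U. p \<in> U \<and> vector_field A U X)"

text \<open>The case distinction keeps the bracket inside \<open>tangent_space\<close>.\<close>

definition lie :: "('m::topological_space, 'n::finite) atlas \<Rightarrow> 'm vfield \<Rightarrow> 'm vfield \<Rightarrow> 'm vfield" where
  "lie A X Y p f = (if smooth_near A p f then X p (\<lambda>q. Y q f) - Y p (\<lambda>q. X q f) else 0)"

definition tangent_linear ::
  "('m::topological_space, 'n::finite) atlas \<Rightarrow> 'm \<Rightarrow> ('m tangent \<Rightarrow> real) \<Rightarrow> bool" where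
  "tangent_linear A p L \<longleftrightarrow> (\<forall>u\<in>tangent_space A p. \<forall>v\<in>tangent_space A p. \<forall>\<alpha> \<beta>.
     L (\<lambda>f. \<alpha> * u f + \<beta> * v f) = \<alpha> * L u + \<beta> * L v)"

definition tangent_bilinear ::
  "('m::topological_space, 'n::finite) atlas \<Rightarrow> 'm \<Rightarrow> ('m tangent \<Rightarrow> 'm tangent \<Rightarrow> real) \<Rightarrow> bool" where
  "tangent_bilinear A p B \<longleftrightarrow> (\<forall>u\<in>tangent_space A p.
     tangent_linear A p (\<lambda>v. B u v) \<and> tangent_linear A p (\<lambda>v. B v u))"

definition tangent_basis ::
  "('m::topological_space, 'n::finite) atlas \<Rightarrow> 'm \<Rightarrow> ('n \<Rightarrow> 'm tangent) \<Rightarrow> bool" where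
  "tangent_basis A p b \<longleftrightarrow> (\<forall>i. b i \<in> tangent_space A p) \<and>
     (\<forall>v\<in>tangent_space A p. \<exists>!c. v = (\<lambda>f. \<Sum>i\<in>UNIV. c i * b i f))"

definition positive_basis ::
  "('m::topological_space, 'n::finite) atlas \<Rightarrow> 'm \<Rightarrow> ('n \<Rightarrow> 'm tangent) \<Rightarrow> bool" where
  "positive_basis A p b \<longleftrightarrow> tangent_basis A p b \<and>
     (\<forall>(D, \<phi>)\<in>A. p \<in> D \<longrightarrow> 0 < det (\<chi> i j. b j (\<lambda>q. \<phi> q $ i)))"

section \<open>Riemannian metrics, the Levi-Civita connection, curvature\<close>

type_synonym 'm bilin_field = "'m \<Rightarrow> 'm tangent \<Rightarrow> 'm tangent \<Rightarrow> real"

definition smooth_bilin_field ::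
  "('m::topological_space, 'n::finite) atlas \<Rightarrow> 'm bilin_field \<Rightarrow> bool" where
  "smooth_bilin_field A B \<longleftrightarrow> (\<forall>p. tangent_bilinear A p (B p)) \<and>
     (\<forall>U X Y. vector_field A U X \<longrightarrow> vector_field A U Y \<longrightarrow>
        smooth_fun_on A U (\<lambda>p. B p (X p) (Y p)))"

definition riemannian_metric ::
  "('m::topological_space, 'n::finite) atlas \<Rightarrow> 'm bilin_field \<Rightarrow> bool" where
  "riemannian_metric A g \<longleftrightarrow> smooth_bilin_field A g \<and>
     (\<forall>p. \<forall>u\<in>tangent_space A p. \<forall>v\<in>tangent_space A p. g p u v = g p v u) \<and>
     (\<forall>p. \<forall>u\<in>tangent_space A p. u \<noteq> (\<lambda>f. 0) \<longrightarrow> 0 < g p u u)"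

definition orthonormal_basis ::
  "('m::topological_space, 'n::finite) atlas \<Rightarrow> 'm bilin_field \<Rightarrow> 'm \<Rightarrow> ('n \<Rightarrow> 'm tangent) \<Rightarrow> bool" where
  "orthonormal_basis A g p b \<longleftrightarrow> tangent_basis A p b \<and>
     (\<forall>i j. g p (b i) (b j) = (if i = j then 1 else 0))"

definition oriented_orthonormal_frame ::
  "('m::topological_space, 'n::finite) atlas \<Rightarrow> 'm bilin_field \<Rightarrow> 'm set \<Rightarrow> ('n \<Rightarrow> 'm vfield) \<Rightarrow> bool" where
  "oriented_orthonormal_frame A g U E \<longleftrightarrow> (\<forall>i. vector_field A U (E i)) \<and>
     (\<forall>p\<in>U. orthonormal_basis A g p (\<lambda>i. E i p) \<and> positive_basis A p (\<lambda>i. E i p))"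

definition dual_coframe ::
  "('m::topological_space, 'n::finite) atlas \<Rightarrow> 'm set \<Rightarrow> ('n \<Rightarrow> 'm vfield) \<Rightarrow>
   ('n \<Rightarrow> 'm \<Rightarrow> 'm tangent \<Rightarrow> real) \<Rightarrow> bool" where
  "dual_coframe A U E w \<longleftrightarrow> (\<forall>p\<in>U. \<forall>i. tangent_linear A p (w i p) \<and>
     (\<forall>j. w i p (E j p) = (if i = j then 1 else 0)))"

type_synonym 'm connection = "'m vfield \<Rightarrow> 'm vfield \<Rightarrow> 'm vfield"

text \<open>The unique torsion-free metric connection, as an operator on local vector fields.  The value
  \<open>nabla X Y p\<close> is constrained only where \<open>X\<close> and \<open>Y\<close> are smooth near \<open>p\<close>; the clauses, being
  required on all open sets, force it to be local.\<close>

definition levi_civita ::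
  "('m::topological_space, 'n::finite) atlas \<Rightarrow> 'm bilin_field \<Rightarrow> 'm connection \<Rightarrow> bool" where
  "levi_civita A g nabla \<longleftrightarrow>
     (\<forall>U X Y Z f. vector_field A U X \<longrightarrow> vector_field A U Y \<longrightarrow> vector_field A U Z \<longrightarrow>
        smooth_fun_on A U f \<longrightarrow>
        vector_field A U (nabla X Y) \<and>
        (\<forall>p\<in>U.
           nabla (\<lambda>q k. X q k + Y q k) Z p = (\<lambda>k. nabla X Z p k + nabla Y Z p k) \<and>
           nabla (\<lambda>q k. f q * X q k) Z p = (\<lambda>k. f p * nabla X Z p k) \<and>
           nabla X (\<lambda>q k. Y q k + Z q k) p = (\<lambda>k. nabla X Y p k + nabla X Z p k) \<and>
           nabla X (\<lambda>q k. f q * Y q k) p = (\<lambda>k. X p f * Y p k + f p * nabla X Y p k) \<and>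
           (\<lambda>k. nabla X Y p k - nabla Y X p k) = lie A X Y p \<and>
           X p (\<lambda>q. g q (Y q) (Z q)) = g p (nabla X Y p) (Z p) + g p (Y p) (nabla X Z p)))"

definition curvature ::
  "('m::topological_space, 'n::finite) atlas \<Rightarrow> 'm connection \<Rightarrow>
   'm vfield \<Rightarrow> 'm vfield \<Rightarrow> 'm vfield \<Rightarrow> 'm vfield" where
  "curvature A nabla X Y Z p = (\<lambda>k. nabla X (nabla Y Z) p k - nabla Y (nabla X Z) p k
     - nabla (lie A X Y) Z p k)"

text \<open>Sectional curvature at \<open>p\<close> of the plane spanned by \<open>X p\<close> and \<open>Y p\<close>.\<close>

definition sectional_curvature ::
  "('m::topological_space, 'n::finite) atlas \<Rightarrow> 'm bilin_field \<Rightarrow> 'm connection \<Rightarrow>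
   'm vfield \<Rightarrow> 'm vfield \<Rightarrow> 'm \<Rightarrow> real" where
  "sectional_curvature A g nabla X Y p =
     g p (curvature A nabla X Y Y p) (X p) /
     (g p (X p) (X p) * g p (Y p) (Y p) - (g p (X p) (Y p))\<^sup>2)"

section \<open>Hessian, Laplacian, norms\<close>

text \<open>Here and below, \<open>THE r\<close> picks the common value over all choices of extensions or of
  orthonormal bases, on which the expressions do not depend.\<close>

definition hessian ::
  "('m::topological_space, 'n::finite) atlas \<Rightarrow> 'm connection \<Rightarrow> ('m \<Rightarrow> real) \<Rightarrow> 'm bilin_field" where
  "hessian A nabla f p u v = (THE r. \<forall>X Y. extends A p u X \<longrightarrow> extends A p v Y \<longrightarrow>
     r = X p (\<lambda>q. Y q f) - nabla X Y p f)"

definition metric_trace ::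
  "('m::topological_space, 'n::finite) atlas \<Rightarrow> 'm bilin_field \<Rightarrow> 'm \<Rightarrow>
   ('m tangent \<Rightarrow> 'm tangent \<Rightarrow> real) \<Rightarrow> real" where
  "metric_trace A g p B = (THE r. \<forall>b. orthonormal_basis A g p b \<longrightarrow> r = (\<Sum>i\<in>UNIV. B (b i) (b i)))"

text \<open>The nonnegative Laplacian.\<close>

definition laplacian ::
  "('m::topological_space, 'n::finite) atlas \<Rightarrow> 'm bilin_field \<Rightarrow> 'm connection \<Rightarrow>
   ('m \<Rightarrow> real) \<Rightarrow> 'm \<Rightarrow> real" where
  "laplacian A g nabla f p = - metric_trace A g p (hessian A nabla f p)"

definition critical_point ::
  "('m::topological_space, 'n::finite) atlas \<Rightarrow> ('m \<Rightarrow> real) \<Rightarrow> 'm \<Rightarrow> bool" where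
  "critical_point A f p \<longleftrightarrow> (\<forall>v\<in>tangent_space A p. v f = 0)"

definition tangent_norm_sq :: "'m bilin_field \<Rightarrow> 'm \<Rightarrow> 'm tangent \<Rightarrow> real" where
  "tangent_norm_sq g p v = g p v v"

text \<open>Squared norm, induced by the metric, of a tangent-vector-valued bilinear form.\<close>

definition bilin_norm_sq ::
  "('m::topological_space, 'n::finite) atlas \<Rightarrow> 'm bilin_field \<Rightarrow> 'm \<Rightarrow>
   ('m tangent \<Rightarrow> 'm tangent \<Rightarrow> 'm tangent) \<Rightarrow> real" where
  "bilin_norm_sq A g p B = (THE r. \<forall>b. orthonormal_basis A g p b \<longrightarrow>
     r = (\<Sum>i\<in>UNIV. \<Sum>j\<in>UNIV. tangent_norm_sq g p (B (b i) (b j))))"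

section \<open>Exterior derivative, Hodge star and codifferential in dimension four\<close>

definition two_form :: "('m::topological_space, 'n::finite) atlas \<Rightarrow> 'm bilin_field \<Rightarrow> bool" where
  "two_form A h \<longleftrightarrow> smooth_bilin_field A h \<and>
     (\<forall>p. \<forall>u\<in>tangent_space A p. \<forall>v\<in>tangent_space A p. h p u v = - h p v u)"

definition ext_deriv ::
  "('m::topological_space, 'n::finite) atlas \<Rightarrow> 'm bilin_field \<Rightarrow>
   'm \<Rightarrow> 'm tangent \<Rightarrow> 'm tangent \<Rightarrow> 'm tangent \<Rightarrow> real" where
  "ext_deriv A h p u v z = (THE r. \<forall>X Y Z.
     extends A p u X \<longrightarrow> extends A p v Y \<longrightarrow> extends A p z Z \<longrightarrow>
     r = X p (\<lambda>q. h q (Y q) (Z q)) - Y p (\<lambda>q. h q (X q) (Z q)) + Z p (\<lambda>q. h q (X q) (Y q))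
       - h p (lie A X Y p) z + h p (lie A X Z p) v - h p (lie A Y Z p) u)"

text \<open>Riemannian volume form, with arguments indexed by \<open>'n\<close>.\<close>

definition volume_form ::
  "('m::topological_space, 'n::finite) atlas \<Rightarrow> 'm bilin_field \<Rightarrow> 'm \<Rightarrow> ('n \<Rightarrow> 'm tangent) \<Rightarrow> real" where
  "volume_form A g p v = (THE r. \<forall>b. orthonormal_basis A g p b \<longrightarrow> positive_basis A p b \<longrightarrow>
     r = det (\<chi> i j. g p (b i) (v j)))"

text \<open>On the index type \<open>4\<close> the numerals 1, 2, 3, 4 denote the four distinct elements.\<close>

definition quad :: "'a \<Rightarrow> 'a \<Rightarrow> 'a \<Rightarrow> 'a \<Rightarrow> 4 \<Rightarrow> 'a" where
  "quad x1 x2 x3 x4 i = (if i = 1 then x1 else if i = 2 then x2 else if i = 3 then x3 else x4)"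

text \<open>The Hodge star of a \<open>k\<close>-form contracts it with the first \<open>k\<close> slots of the volume form, so that
  \<open>\<alpha> \<and> *\<beta> = \<langle>\<alpha>, \<beta>\<rangle> vol\<close>; the factors 1/2 and 1/6 replace summing over increasing indices.\<close>

definition hodge_star2 ::
  "('m::topological_space, 4) atlas \<Rightarrow> 'm bilin_field \<Rightarrow> 'm bilin_field \<Rightarrow> 'm bilin_field" where
  "hodge_star2 A g h p u v = (THE r. \<forall>b. orthonormal_basis A g p b \<longrightarrow>
     r = (\<Sum>i\<in>UNIV. \<Sum>j\<in>UNIV. h p (b i) (b j) * volume_form A g p (quad (b i) (b j) u v)) / 2)"

definition hodge_star3 ::
  "('m::topological_space, 4) atlas \<Rightarrow> 'm bilin_field \<Rightarrow>
   ('m \<Rightarrow> 'm tangent \<Rightarrow> 'm tangent \<Rightarrow> 'm tangent \<Rightarrow> real) \<Rightarrow> 'm \<Rightarrow> 'm tangent \<Rightarrow> real" where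
  "hodge_star3 A g \<theta> p u = (THE r. \<forall>b. orthonormal_basis A g p b \<longrightarrow>
     r = (\<Sum>i\<in>UNIV. \<Sum>j\<in>UNIV. \<Sum>k\<in>UNIV.
            \<theta> p (b i) (b j) (b k) * volume_form A g p (quad (b i) (b j) (b k) u)) / 6)"

text \<open>In even dimension \<open>d\<^sup>* = - * d *\<close> on forms of every degree.\<close>

definition codifferential ::
  "('m::topological_space, 4) atlas \<Rightarrow> 'm bilin_field \<Rightarrow> 'm bilin_field \<Rightarrow> 'm \<Rightarrow> 'm tangent \<Rightarrow> real" where
  "codifferential A g h p u = - hodge_star3 A g (ext_deriv A (hodge_star2 A g h)) p u"

definition closed_form :: "('m::topological_space, 'n::finite) atlas \<Rightarrow> 'm bilin_field \<Rightarrow> bool" where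
  "closed_form A h \<longleftrightarrow> (\<forall>p. \<forall>u\<in>tangent_space A p. \<forall>v\<in>tangent_space A p. \<forall>z\<in>tangent_space A p.
     ext_deriv A h p u v z = 0)"

definition coclosed_form :: "('m::topological_space, 4) atlas \<Rightarrow> 'm bilin_field \<Rightarrow> 'm bilin_field \<Rightarrow> bool" where
  "coclosed_form A g h \<longleftrightarrow> (\<forall>p. \<forall>u\<in>tangent_space A p. codifferential A g h p u = 0)"

definition self_dual_at ::
  "('m::topological_space, 4) atlas \<Rightarrow> 'm bilin_field \<Rightarrow> 'm bilin_field \<Rightarrow> 'm \<Rightarrow> bool" where
  "self_dual_at A g h p \<longleftrightarrow> (\<forall>u\<in>tangent_space A p. \<forall>v\<in>tangent_space A p.
     hodge_star2 A g h p u v = h p u v)"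

definition anti_self_dual_at ::
  "('m::topological_space, 4) atlas \<Rightarrow> 'm bilin_field \<Rightarrow> 'm bilin_field \<Rightarrow> 'm \<Rightarrow> bool" where
  "anti_self_dual_at A g h p \<longleftrightarrow> (\<forall>u\<in>tangent_space A p. \<forall>v\<in>tangent_space A p.
     hodge_star2 A g h p u v = - h p u v)"

definition wedge :: "('m tangent \<Rightarrow> real) \<Rightarrow> ('m tangent \<Rightarrow> real) \<Rightarrow> 'm tangent \<Rightarrow> 'm tangent \<Rightarrow> real" where
  "wedge \<alpha> \<beta> u v = \<alpha> u * \<beta> v - \<alpha> v * \<beta> u"

section \<open>Torsion vectors and second fundamental forms of a frame\<close>

text \<open>Below, \<open>\<gamma> i j k p\<close> stands for the coefficient of \<open>E k p\<close> in \<open>nabla (E i) (E j) p\<close>.\<close>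

definition connection_coefficients ::
  "'m set \<Rightarrow> 'm connection \<Rightarrow> ('n::finite \<Rightarrow> 'm vfield) \<Rightarrow> ('n \<Rightarrow> 'n \<Rightarrow> 'n \<Rightarrow> 'm \<Rightarrow> real) \<Rightarrow> bool" where
  "connection_coefficients U nabla E \<gamma> \<longleftrightarrow>
     (\<forall>p\<in>U. \<forall>i j. nabla (E i) (E j) p = (\<lambda>k. \<Sum>l\<in>UNIV. \<gamma> i j l p * E l p k))"

text \<open>Component in the span of \<open>E m\<close>, \<open>m \<in> Q\<close>, of the vector with coefficients \<open>\<gamma> i j m - \<gamma> j i m\<close>.\<close>

definition torsion_vector ::
  "('n \<Rightarrow> 'm vfield) \<Rightarrow> ('n \<Rightarrow> 'n \<Rightarrow> 'n \<Rightarrow> 'm \<Rightarrow> real) \<Rightarrow> 'n \<Rightarrow> 'n \<Rightarrow> 'n set \<Rightarrow> 'm vfield" where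
  "torsion_vector E \<gamma> i j Q p = (\<lambda>k. \<Sum>m\<in>Q. (\<gamma> i j m p - \<gamma> j i m p) * E m p k)"

text \<open>Generalized second fundamental form of the distribution spanned by \<open>E i\<close>, \<open>i \<in> P\<close>, with values
  in the complementary distribution spanned by \<open>E m\<close>, \<open>m \<in> Q\<close>.\<close>

definition second_fundamental_form ::
  "('n \<Rightarrow> 'm vfield) \<Rightarrow> ('n \<Rightarrow> 'm \<Rightarrow> 'm tangent \<Rightarrow> real) \<Rightarrow> ('n \<Rightarrow> 'n \<Rightarrow> 'n \<Rightarrow> 'm \<Rightarrow> real) \<Rightarrow>
   'n set \<Rightarrow> 'n set \<Rightarrow> 'm \<Rightarrow> 'm tangent \<Rightarrow> 'm tangent \<Rightarrow> 'm tangent" where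
  "second_fundamental_form E w \<gamma> P Q p u v = (\<lambda>k. \<Sum>i\<in>P. \<Sum>j\<in>P. \<Sum>m\<in>Q.
     (\<gamma> i j m p + \<gamma> j i m p) / 2 * w i p u * w j p v * E m p k)"

end

theory Submission
  imports Defs
begin

text \<open>Put \<open>c\<^sub>i\<^sub>j\<^sup>k = \<gamma>\<^sub>i\<^sub>j\<^sup>k - \<gamma>\<^sub>j\<^sub>i\<^sup>k\<close>.  The component of \<open>dh = 0\<close> on \<open>e\<^sub>1, e\<^sub>2, e\<^sub>3\<close> reads
  \<open>e\<^sub>3 a + a (c\<^sub>1\<^sub>3\<^sup>1 + c\<^sub>2\<^sub>3\<^sup>2) + b c\<^sub>1\<^sub>2\<^sup>4 = 0\<close>.  Since \<open>*h = b w\<^sup>1 \<and> w\<^sup>2 + a w\<^sup>3 \<and> w\<^sup>4\<close>, coclosedness gives the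
  same equation with \<open>a\<close> and \<open>b\<close> exchanged, and in \<open>(a e\<^sub>3 a - b e\<^sub>3 b) / (a\<^sup>2 - b\<^sup>2)\<close> the torsion terms
  cancel.  Hence \<open>e\<^sub>3 f = \<gamma>\<^sub>1\<^sub>1\<^sup>3 + \<gamma>\<^sub>2\<^sub>2\<^sup>3\<close>, and likewise for the other components: the gradient of
  \<open>f\<close> is the sum of the mean curvature vectors of the two distributions.  At a critical point these
  vectors vanish, the trace of the Hessian is the sum of the \<open>e\<^sub>i (e\<^sub>i f)\<close>, and the derivatives of the
  connection coefficients occurring there are exactly those of the four mixed sectional curvatures;
  the remaining terms are quadratic in the coefficients and are compared algebraically.\<close>

section \<open>Smooth functions on open subsets of a normed space\<close>

text \<open>The factor 1/2 before the torsion terms turns norms into traces. For m in {3,4} let S be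
  the 2x2 matrix with entries \<open>\<gamma> i j m\<close>, i, j in {1,2}. Splitting S into its
  symmetric and antisymmetric parts shows that tr(S^2) is the contribution of m to |II_a|^2 -
  |T_a|^2/2; likewise for II_b and T_b. Once the mean curvatures vanish, the four mixed sectional
  curvatures add up to the derivative terms minus all these traces; the other quadratic terms cancel
  by antisymmetry of the coefficients in the last two indices. Two obstacles shape the rest.
  Laplacian, exterior derivative, volume form, Hodge star and norms are definite descriptions over
  all extensions or bases, so each must be shown independent of the choice. The given frame supplies
  a basis to evaluate in and, by constant coefficients, an extension of every tangent vector; the
  Hessian is treated only at critical points, where its connection term vanishes. Moreover, tangent
  vectors are abstract derivations: they are handled only through linearity, the Leibniz rule and
  locality, never through partial derivatives.\<close>

lemma Ck_on_subset: "Ck_on k S f \<Longrightarrow> T \<subseteq> S \<Longrightarrow> Ck_on k T f"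
  by (induction k arbitrary: f) (auto intro: continuous_on_subset)

lemma Ck_on_SucD: "Ck_on (Suc k) S f \<Longrightarrow> Ck_on k S f"
proof (induction k arbitrary: f)
  case 0
  then show ?case
    by (auto intro!: continuous_at_imp_continuous_on differentiable_imp_continuous_within)
next
  case (Suc k)
  then show ?case by (metis Ck_on.simps(2))
qed

text \<open>A derivative at a point sees a whole neighbourhood, so agreement on an open set passes
  to derivatives of every order. The closure lemmas below use this to trade the derivative of a sum,
  product or composite for its explicit formula, which is valid only on \<open>S\<close>.\<close>

lemma Ck_on_cong:
  assumes "open S" "\<And>x. x \<in> S \<Longrightarrow> f x = g x" "Ck_on k S f"
  shows "Ck_on k S g"
  using assms(2,3)
proof (induction k arbitrary: f g)
  case 0
  then show ?case by (simp cong: continuous_on_cong)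
next
  case (Suc k)
  have *: "g differentiable at x" "frechet_derivative f (at x) = frechet_derivative g (at x)"
    if "x \<in> S" for x
  proof -
    have f: "f differentiable at x" using Suc.prems that by simp
    then obtain D where "(f has_derivative D) (at x)" by (auto simp: differentiable_def)
    then have "(g has_derivative D) (at x)"
      using has_derivative_transform_within_open[OF _ \<open>open S\<close> that] Suc.prems(1) by blast
    then show "g differentiable at x" by (auto simp: differentiable_def)
    show "frechet_derivative f (at x) = frechet_derivative g (at x)"
      by (rule frechet_derivative_transform_within_open[OF f \<open>open S\<close> that]) (rule Suc.prems)
  qed
  have "Ck_on k S (\<lambda>x. frechet_derivative g (at x) v)" for v
    by (rule Suc.IH[of "\<lambda>x. frechet_derivative f (at x) v"]) (use * Suc.prems(2) in auto)
  then show ?case using * by simp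
qed

lemma Ck_on_const [simp]: "Ck_on k S (\<lambda>x. c)"
  by (induction k arbitrary: c) auto

lemma Ck_on_add:
  assumes "open S" "Ck_on k S f" "Ck_on k S g"
  shows "Ck_on k S (\<lambda>x. f x + g x)"
  using assms(2,3)
proof (induction k arbitrary: f g)
  case 0
  then show ?case by (auto intro: continuous_intros)
next
  case (Suc k)
  have eq: "frechet_derivative f (at x) v + frechet_derivative g (at x) v
      = frechet_derivative (\<lambda>x. f x + g x) (at x) v" if "x \<in> S" for x v
  proof -
    have "((\<lambda>x. f x + g x) has_derivative
        (\<lambda>v. frechet_derivative f (at x) v + frechet_derivative g (at x) v)) (at x)"
      using Suc.prems that by (intro has_derivative_add) (simp_all flip: frechet_derivative_works)
    from frechet_derivative_at[OF this] show ?thesis by metis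
  qed
  have "Ck_on k S (\<lambda>x. frechet_derivative f (at x) v + frechet_derivative g (at x) v)" for v
    using Suc.prems by (intro Suc.IH) simp_all
  then have "Ck_on k S (\<lambda>x. frechet_derivative (\<lambda>x. f x + g x) (at x) v)" for v
    by (rule Ck_on_cong[OF \<open>open S\<close>, rotated]) (rule eq)
  then show ?case
    using Suc.prems by simp
qed

lemma Ck_on_mult:
  fixes f g :: "'a::real_normed_vector \<Rightarrow> real"
  assumes "open S" "Ck_on k S f" "Ck_on k S g"
  shows "Ck_on k S (\<lambda>x. f x * g x)"
  using assms(2,3)
proof (induction k arbitrary: f g)
  case 0
  then show ?case by (auto intro: continuous_intros)
next
  case (Suc k)
  have eq: "f x * frechet_derivative g (at x) v + frechet_derivative f (at x) v * g x
      = frechet_derivative (\<lambda>x. f x * g x) (at x) v" if "x \<in> S" for x v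
  proof -
    have "((\<lambda>x. f x * g x) has_derivative
        (\<lambda>v. f x * frechet_derivative g (at x) v + frechet_derivative f (at x) v * g x)) (at x)"
      using Suc.prems that by (intro has_derivative_mult) (simp_all flip: frechet_derivative_works)
    from frechet_derivative_at[OF this] show ?thesis by metis
  qed
  have "Ck_on k S (\<lambda>x. f x * frechet_derivative g (at x) v + frechet_derivative f (at x) v * g x)" for v
    using Suc.prems Suc.prems[THEN Ck_on_SucD]
    by (intro Ck_on_add[OF \<open>open S\<close>] Suc.IH) (simp_all del: Ck_on.simps(1))
  then have "Ck_on k S (\<lambda>x. frechet_derivative (\<lambda>x. f x * g x) (at x) v)" for v
    by (rule Ck_on_cong[OF \<open>open S\<close>, rotated]) (rule eq)
  then show ?case
    using Suc.prems by simp
qed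

text \<open>With a real variable in between, the chain rule becomes a product of scalars: the
  derivative of \<open>f\<close> in direction \<open>v\<close> times the derivative of
  \<open>\<psi>\<close> in direction 1. Closure under products then completes the induction, in
  which \<open>\<psi>\<close> varies and \<open>f\<close> stays fixed.\<close>

lemma Ck_on_compose_real:
  fixes f :: "'a::real_normed_vector \<Rightarrow> real" and \<psi> :: "real \<Rightarrow> real"
  assumes "open S" "Ck_on k S f" "Ck_on k T \<psi>" "f ` S \<subseteq> T"
  shows "Ck_on k S (\<lambda>x. \<psi> (f x))"
  using assms(2,3)
proof (induction k arbitrary: \<psi>)
  case 0
  then show ?case using assms(4) by (auto intro: continuous_on_compose2)
next
  case (Suc k)
  have *: "(\<lambda>x. \<psi> (f x)) differentiable at x \<and>
      frechet_derivative f (at x) v * frechet_derivative \<psi> (at (f x)) 1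
        = frechet_derivative (\<lambda>x. \<psi> (f x)) (at x) v" if "x \<in> S" for x v
  proof -
    have f: "f differentiable at x" and \<psi>: "\<psi> differentiable at (f x)"
      using Suc.prems that assms(4) by auto
    interpret L: bounded_linear "frechet_derivative \<psi> (at (f x))"
      using \<psi> frechet_derivative_works has_derivative_bounded_linear by blast
    have "frechet_derivative (\<lambda>x. \<psi> (f x)) (at x) v
        = frechet_derivative \<psi> (at (f x)) (frechet_derivative f (at x) v *\<^sub>R 1)"
      using frechet_derivative_compose[OF f \<psi>] by (simp add: o_def)
    also have "\<dots> = frechet_derivative f (at x) v * frechet_derivative \<psi> (at (f x)) 1"
      by (subst L.scaleR) simp
    finally show ?thesis
      using differentiable_chain_at[OF f \<psi>] by (simp add: o_def)
  qed
  have "Ck_on k S (\<lambda>x. frechet_derivative f (at x) v * frechet_derivative \<psi> (at (f x)) 1)" for v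
    using Suc.prems Ck_on_SucD[OF Suc.prems(1)]
    by (intro Ck_on_mult[OF \<open>open S\<close>] Suc.IH[of "\<lambda>y. frechet_derivative \<psi> (at y) 1"]) auto
  then have "Ck_on k S (\<lambda>x. frechet_derivative (\<lambda>x. \<psi> (f x)) (at x) v)" for v
    by (rule Ck_on_cong[OF \<open>open S\<close>, rotated]) (use * in blast)
  then show ?case using * by auto
qed

section \<open>Smoothness of the logarithm and of power series\<close>

lemma Ck_on_real_deriv:
  fixes f f' :: "real \<Rightarrow> real"
  assumes "open S" "\<And>x. x \<in> S \<Longrightarrow> (f has_real_derivative f' x) (at x)" "Ck_on k S f'"
  shows "Ck_on (Suc k) S f"
proof -
  have d: "(f has_derivative (*) (f' x)) (at x)" if "x \<in> S" for x
    using assms(2)[OF that] by (simp add: has_field_derivative_def)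
  have "Ck_on k S (\<lambda>x. frechet_derivative f (at x) v)" for v
    by (rule Ck_on_cong[OF assms(1) _ Ck_on_mult[OF assms(1,3) Ck_on_const[of _ _ v]]])
       (use d frechet_derivative_at in metis)
  then show ?thesis using d by (auto simp: differentiable_def)
qed

text \<open>The derivative of \<open>inverse\<close> is a polynomial in \<open>inverse\<close>, so
  each order of smoothness yields the next. The logarithm follows because its derivative is
  \<open>inverse\<close>.\<close>

lemma Ck_on_inverse: "Ck_on k {0<..} (inverse :: real \<Rightarrow> real)"
proof (induction k)
  case 0
  then show ?case by (auto intro!: continuous_intros)
next
  case (Suc k)
  show ?case
  proof (rule Ck_on_real_deriv)
    show "(inverse has_real_derivative - 1 * (inverse x * inverse x)) (at x)" if "x \<in> {0<..}" for x :: real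
      using that DERIV_inverse[of x] by (simp add: power2_eq_square)
    show "Ck_on k {0<..} (\<lambda>x::real. - 1 * (inverse x * inverse x))"
      by (intro Ck_on_mult Ck_on_const Suc.IH) auto
  qed simp
qed

lemma smooth_on_ln: "smooth_on {0<..} (ln :: real \<Rightarrow> real)"
  unfolding smooth_on_def
proof
  fix k
  have "Ck_on (Suc k) {0<..} (ln :: real \<Rightarrow> real)"
    by (rule Ck_on_real_deriv[OF _ _ Ck_on_inverse]) (use DERIV_ln in auto)
  then show "Ck_on k {0<..} (ln :: real \<Rightarrow> real)" by (rule Ck_on_SucD)
qed

text \<open>Termwise differentiation replaces \<open>c\<close> by \<open>diffs c\<close>, whose
  series converges on the same ball; the induction therefore runs over all coefficient sequences. In
  the base case the derivative is continuous because it is again differentiable.\<close>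

lemma smooth_on_power_series:
  fixes c :: "nat \<Rightarrow> real"
  assumes "\<And>x. norm x < R \<Longrightarrow> summable (\<lambda>n. c n * x ^ n)"
  shows "smooth_on (ball 0 R) (\<lambda>x. \<Sum>n. c n * x ^ n)"
  unfolding smooth_on_def
proof
  fix k
  have "Ck_on (Suc k) (ball 0 R) (\<lambda>x. \<Sum>n. c n * x ^ n)"
    using assms
  proof (induction k arbitrary: c)
    case 0
    have d: "((\<lambda>x. \<Sum>n. c n * x ^ n) has_real_derivative (\<Sum>n. diffs c n * x ^ n)) (at x)"
      if "x \<in> ball 0 R" for x
      using termdiffs_strong'[of R c x] 0 that by auto
    have d': "((\<lambda>x. \<Sum>n. diffs c n * x ^ n) has_real_derivative (\<Sum>n. diffs (diffs c) n * x ^ n)) (at x)"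
      if "x \<in> ball 0 R" for x
      using termdiffs_strong'[of R "diffs c" x] termdiff_converges[of _ R c] 0 that by auto
    show ?case
      by (rule Ck_on_real_deriv[OF open_ball d])
         (use d' in \<open>auto intro!: continuous_at_imp_continuous_on DERIV_isCont\<close>)
  next
    case (Suc k)
    have d: "((\<lambda>x. \<Sum>n. c n * x ^ n) has_real_derivative (\<Sum>n. diffs c n * x ^ n)) (at x)"
      if "x \<in> ball 0 R" for x
      using termdiffs_strong'[of R c x] Suc.prems that by auto
    show ?case
      by (rule Ck_on_real_deriv[OF open_ball d Suc.IH])
         (use termdiff_converges[of _ R c] Suc.prems in auto)
  qed
  then show "Ck_on k (ball 0 R) (\<lambda>x. \<Sum>n. c n * x ^ n)" by (rule Ck_on_SucD)
qed

text \<open>The series of ln(1 + x) has no constant term; pulling out one factor x leaves the power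
  series with coefficients (-1)^n / (n + 1), whose value at 0 is 1. Comparison with the geometric
  series gives convergence for |x| < 1.\<close>

lemma ln_one_plus_factor:
  obtains S :: "real \<Rightarrow> real"
  where "smooth_on (ball 0 1) S" "S 0 = 1" "\<And>x. x \<in> ball 0 1 \<Longrightarrow> ln (1 + x) = x * S x"
proof
  let ?c = "\<lambda>n. (-1) ^ n * (1 / real (n + 1))"
  have s: "summable (\<lambda>n. ?c n * x ^ n)" if "norm x < 1" for x :: real
  proof (rule summable_comparison_test'[OF summable_geometric[of "\<bar>x\<bar>"]])
    show "norm \<bar>x\<bar> < 1" using that by simp
    show "norm (?c n * x ^ n) \<le> \<bar>x\<bar> ^ n" for n
    proof -
      have "norm (?c n * x ^ n) = 1 / real (n + 1) * \<bar>x\<bar> ^ n"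
        by (simp only: norm_mult norm_power real_norm_def abs_minus_cancel abs_one power_one)
           (simp add: abs_mult power_abs)
      also have "\<dots> \<le> 1 * \<bar>x\<bar> ^ n"
        by (rule mult_right_mono) auto
      finally show ?thesis by simp
    qed
  qed
  show "smooth_on (ball 0 1) (\<lambda>x. \<Sum>n. ?c n * x ^ n)"
    by (rule smooth_on_power_series) (rule s)
  show "(\<Sum>n. ?c n * 0 ^ n) = 1"
    by (subst powser_zero) simp
  show "ln (1 + x) = x * (\<Sum>n. ?c n * x ^ n)" if "x \<in> ball 0 1" for x
  proof -
    have "ln (1 + x) = (\<Sum>n. x * (?c n * x ^ n))"
      using ln_series[of "1 + x"] that by (simp add: ac_simps)
    also have "\<dots> = x * (\<Sum>n. ?c n * x ^ n)"
      using that by (intro suminf_mult s) auto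
    finally show ?thesis .
  qed
qed

section \<open>Smooth functions and tangent vectors on a manifold\<close>

locale oriented_manifold =
  fixes A :: "('m::{t2_space, second_countable_topology}, 'n::finite) atlas"
  assumes oriented_atlas: "oriented_atlas A"
begin

lemma chart_in_atlas: "(D, \<phi>) \<in> A \<Longrightarrow> chart D \<phi>"
  using oriented_atlas by (auto simp: oriented_atlas_def)

lemma chart_at: obtains D \<phi> where "(D, \<phi>) \<in> A" "q \<in> D"
proof -
  have "q \<in> (\<Union>(D, \<phi>)\<in>A. D)" using oriented_atlas by (simp add: oriented_atlas_def)
  then show thesis using that by auto
qed

lemma chart_inverse: "(D, \<phi>) \<in> A \<Longrightarrow> q \<in> D \<Longrightarrow> inv_into D \<phi> (\<phi> q) = q"
  using chart_in_atlas[of D \<phi>] by (auto simp: chart_def homeomorphism_def)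

lemma open_chart_image:
  assumes "(D, \<phi>) \<in> A" "open V"
  shows "open (\<phi> ` (D \<inter> V))"
proof -
  have c: "open (\<phi> ` D)" "homeomorphism D (\<phi> ` D) \<phi> (inv_into D \<phi>)"
    using chart_in_atlas[OF assms(1)] by (auto simp: chart_def)
  have "openin (top_of_set (\<phi> ` D)) (\<phi> ` (D \<inter> V))"
    by (rule homeomorphism_imp_open_map[OF c(2)]) (use assms(2) in auto)
  with c(1) show ?thesis using openin_open_eq by blast
qed

lemma smooth_fun_on_iff:
  "smooth_fun_on A V f \<longleftrightarrow> open V \<and>
    (\<forall>D \<phi> k. (D, \<phi>) \<in> A \<longrightarrow> Ck_on k (\<phi> ` (D \<inter> V)) (\<lambda>x. f (inv_into D \<phi> x)))"
  by (auto simp: smooth_fun_on_def smooth_on_def o_def)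

lemma smooth_fun_on_open: "smooth_fun_on A V f \<Longrightarrow> open V"
  by (simp add: smooth_fun_on_def)

lemma smooth_fun_on_subset: "smooth_fun_on A V f \<Longrightarrow> open W \<Longrightarrow> W \<subseteq> V \<Longrightarrow> smooth_fun_on A W f"
  unfolding smooth_fun_on_iff by (blast intro: Ck_on_subset)

lemma smooth_fun_on_cong:
  assumes "smooth_fun_on A V f" "\<And>q. q \<in> V \<Longrightarrow> f q = k q"
  shows "smooth_fun_on A V k"
  unfolding smooth_fun_on_iff
proof (intro conjI allI impI)
  show V: "open V" using assms(1) by (rule smooth_fun_on_open)
  fix D \<phi> i
  assume D: "(D, \<phi>) \<in> A"
  have "Ck_on i (\<phi> ` (D \<inter> V)) (\<lambda>x. f (inv_into D \<phi> x))"
    using assms(1) D by (auto simp: smooth_fun_on_iff)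
  then show "Ck_on i (\<phi> ` (D \<inter> V)) (\<lambda>x. k (inv_into D \<phi> x))"
    by (rule Ck_on_cong[OF open_chart_image[OF D V], rotated])
       (use assms(2) chart_inverse[OF D] in auto)
qed

lemma smooth_fun_on_const: "open V \<Longrightarrow> smooth_fun_on A V (\<lambda>q. c)"
  by (simp add: smooth_fun_on_iff)

lemma smooth_fun_on_add:
  "smooth_fun_on A V f \<Longrightarrow> smooth_fun_on A V k \<Longrightarrow> smooth_fun_on A V (\<lambda>q. f q + k q)"
  by (simp add: smooth_fun_on_iff Ck_on_add open_chart_image)

lemma smooth_fun_on_mult:
  "smooth_fun_on A V f \<Longrightarrow> smooth_fun_on A V k \<Longrightarrow> smooth_fun_on A V (\<lambda>q. f q * k q)"
  by (simp add: smooth_fun_on_iff Ck_on_mult open_chart_image)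

lemma smooth_fun_on_cmult: "smooth_fun_on A V f \<Longrightarrow> smooth_fun_on A V (\<lambda>q. c * f q)"
  by (rule smooth_fun_on_mult[OF smooth_fun_on_const]) (rule smooth_fun_on_open)

lemma smooth_fun_on_uminus: "smooth_fun_on A V f \<Longrightarrow> smooth_fun_on A V (\<lambda>q. - f q)"
  using smooth_fun_on_cmult[of V f "-1"] by simp

lemma smooth_fun_on_diff:
  "smooth_fun_on A V f \<Longrightarrow> smooth_fun_on A V k \<Longrightarrow> smooth_fun_on A V (\<lambda>q. f q - k q)"
  using smooth_fun_on_add[OF _ smooth_fun_on_uminus, of V f k] by simp

lemma smooth_fun_on_sum:
  assumes "open V" "\<And>i. i \<in> I \<Longrightarrow> smooth_fun_on A V (f i)"
  shows "smooth_fun_on A V (\<lambda>q. \<Sum>i\<in>I. f i q)"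
  using assms(2)
  by (induction I rule: infinite_finite_induct)
     (auto intro: smooth_fun_on_const smooth_fun_on_add assms(1))

lemma smooth_fun_on_compose_real:
  fixes \<psi> :: "real \<Rightarrow> real"
  assumes "smooth_fun_on A V f" "smooth_on T \<psi>" "f ` V \<subseteq> T"
  shows "smooth_fun_on A V (\<lambda>q. \<psi> (f q))"
  unfolding smooth_fun_on_iff
proof (intro conjI allI impI)
  show V: "open V" using assms(1) by (rule smooth_fun_on_open)
  fix D \<phi> k
  assume D: "(D, \<phi>) \<in> A"
  show "Ck_on k (\<phi> ` (D \<inter> V)) (\<lambda>x. \<psi> (f (inv_into D \<phi> x)))"
  proof (rule Ck_on_compose_real[where \<psi> = \<psi> and f = "\<lambda>x. f (inv_into D \<phi> x)",
        OF open_chart_image[OF D V]])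
    show "Ck_on k (\<phi> ` (D \<inter> V)) (\<lambda>x. f (inv_into D \<phi> x))"
      using assms(1) D by (auto simp: smooth_fun_on_iff)
    show "Ck_on k T \<psi>" using assms(2) by (simp add: smooth_on_def)
    show "(\<lambda>x. f (inv_into D \<phi> x)) ` \<phi> ` (D \<inter> V) \<subseteq> T"
      using assms(3) chart_inverse[OF D] by auto
  qed
qed

text \<open>Composing with a chart and its inverse reduces this to order 0 of \<open>Ck_on\<close>.
  It serves to make preimages of open sets open, as in the choice of the neighbourhood in
  \<open>tangent_ln\<close>.\<close>

lemma smooth_fun_on_continuous:
  assumes "smooth_fun_on A V f"
  shows "continuous_on V f"
proof -
  have V: "open V" using assms by (rule smooth_fun_on_open)
  have "isCont f q" if "q \<in> V" for q
  proof -
    obtain D \<phi> where D: "(D, \<phi>) \<in> A" "q \<in> D" by (rule chart_at)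
    have c: "open D" "continuous_on D \<phi>"
      using chart_in_atlas[OF D(1)] by (auto simp: chart_def homeomorphism_def)
    have "Ck_on 0 (\<phi> ` (D \<inter> V)) (\<lambda>x. f (inv_into D \<phi> x))"
      using assms D unfolding smooth_fun_on_iff by blast
    then have "continuous_on (D \<inter> V) (\<lambda>q. f (inv_into D \<phi> (\<phi> q)))"
      using c(2) by (auto intro: continuous_on_compose2 continuous_on_subset)
    then have "continuous_on (D \<inter> V) f"
      by (rule continuous_on_eq) (use chart_inverse[OF D(1)] in simp)
    then show ?thesis
      using continuous_on_eq_continuous_at[of "D \<inter> V" f] c(1) V D(2) that by auto
  qed
  then show ?thesis by (simp add: continuous_at_imp_continuous_on)
qed

section \<open>Germs of smooth functions and derivations\<close>

lemma smooth_nearI: "smooth_fun_on A V f \<Longrightarrow> p \<in> V \<Longrightarrow> smooth_near A p f"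
  by (auto simp: smooth_near_def)

lemma smooth_near_common:
  assumes "smooth_near A p f" "smooth_near A p k"
  obtains V where "p \<in> V" "smooth_fun_on A V f" "smooth_fun_on A V k"
proof -
  obtain V W where *: "p \<in> V" "smooth_fun_on A V f" "p \<in> W" "smooth_fun_on A W k"
    using assms by (auto simp: smooth_near_def)
  have "open (V \<inter> W)" using * by (auto dest: smooth_fun_on_open)
  then show thesis
    using * that[of "V \<inter> W"] by (auto intro: smooth_fun_on_subset)
qed

lemma smooth_near_const: "smooth_near A p (\<lambda>q. c)"
  using smooth_nearI[OF smooth_fun_on_const[OF open_UNIV]] by auto

lemma smooth_near_add:
  "smooth_near A p f \<Longrightarrow> smooth_near A p k \<Longrightarrow> smooth_near A p (\<lambda>q. f q + k q)"
  by (metis smooth_near_common smooth_fun_on_add smooth_nearI)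

lemma smooth_near_mult:
  "smooth_near A p f \<Longrightarrow> smooth_near A p k \<Longrightarrow> smooth_near A p (\<lambda>q. f q * k q)"
  by (metis smooth_near_common smooth_fun_on_mult smooth_nearI)

lemma smooth_near_cmult: "smooth_near A p f \<Longrightarrow> smooth_near A p (\<lambda>q. c * f q)"
  by (rule smooth_near_mult[OF smooth_near_const])

lemma smooth_near_sum:
  assumes "\<And>i. i \<in> I \<Longrightarrow> smooth_near A p (f i)"
  shows "smooth_near A p (\<lambda>q. \<Sum>i\<in>I. f i q)"
  using assms
  by (induction I rule: infinite_finite_induct) (auto intro: smooth_near_const smooth_near_add)

lemma smooth_near_cong:
  assumes "smooth_near A p f" "open V" "p \<in> V" "\<And>q. q \<in> V \<Longrightarrow> f q = k q"
  shows "smooth_near A p k"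
proof -
  obtain W where W: "p \<in> W" "smooth_fun_on A W f"
    using assms(1) by (auto simp: smooth_near_def)
  have "smooth_fun_on A (V \<inter> W) k"
    by (rule smooth_fun_on_cong[OF smooth_fun_on_subset[OF W(2)]])
       (use assms W smooth_fun_on_open in auto)
  then show ?thesis using W(1) assms(3) by (auto intro: smooth_nearI)
qed

lemma tangent_add:
  "v \<in> tangent_space A p \<Longrightarrow> smooth_near A p f \<Longrightarrow> smooth_near A p k \<Longrightarrow>
    v (\<lambda>q. f q + k q) = v f + v k"
  by (simp add: tangent_space_def)

lemma tangent_mult:
  "v \<in> tangent_space A p \<Longrightarrow> smooth_near A p f \<Longrightarrow> smooth_near A p k \<Longrightarrow>
    v (\<lambda>q. f q * k q) = f p * v k + k p * v f"
  by (simp add: tangent_space_def)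

lemma tangent_cmult:
  "v \<in> tangent_space A p \<Longrightarrow> smooth_near A p f \<Longrightarrow> v (\<lambda>q. c * f q) = c * v f"
  by (simp add: tangent_space_def)

lemma tangent_const:
  assumes "v \<in> tangent_space A p"
  shows "v (\<lambda>q. c) = 0"
proof -
  have "v (\<lambda>q. 1) = 0"
    using tangent_mult[OF assms smooth_near_const smooth_near_const, of 1 1] by simp
  then show ?thesis
    using tangent_cmult[OF assms smooth_near_const, of c 1] by simp
qed

lemma tangent_uminus:
  "v \<in> tangent_space A p \<Longrightarrow> smooth_near A p f \<Longrightarrow> v (\<lambda>q. - f q) = - v f"
  using tangent_cmult[of v p f "-1"] by simp

lemma tangent_diff:
  assumes "v \<in> tangent_space A p" "smooth_near A p f" "smooth_near A p k"
  shows "v (\<lambda>q. f q - k q) = v f - v k"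
  using tangent_add[OF assms(1,2) smooth_near_cmult[OF assms(3), of "-1"]] tangent_uminus[OF assms(1,3)]
  by simp

lemma tangent_sum:
  assumes "v \<in> tangent_space A p" "\<And>i. i \<in> I \<Longrightarrow> smooth_near A p (f i)"
  shows "v (\<lambda>q. \<Sum>i\<in>I. f i q) = (\<Sum>i\<in>I. v (f i))"
  using assms(2)
  by (induction I rule: infinite_finite_induct)
     (auto simp: tangent_const[OF assms(1)] tangent_add[OF assms(1)] smooth_near_sum)

text \<open>No bump functions are needed: if \<open>d\<close> vanishes near \<open>p\<close>, then \<open>d = \<eta> d\<close> for the indicator
  function \<open>\<eta>\<close> of the complement of a neighbourhood of \<open>p\<close>, which is smooth near \<open>p\<close>.\<close>

lemma tangent_cong:
  assumes v: "v \<in> tangent_space A p" and f: "smooth_near A p f"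
    and V: "open V" "p \<in> V" and eq: "\<And>q. q \<in> V \<Longrightarrow> f q = k q"
  shows "v f = v k"
proof -
  define d where "d = (\<lambda>q. f q - k q)"
  define \<eta> :: "'m \<Rightarrow> real" where "\<eta> = (\<lambda>q. if q \<in> V then 0 else 1)"
  have k: "smooth_near A p k" by (rule smooth_near_cong[OF f V eq])
  have d: "smooth_near A p d" and \<eta>: "smooth_near A p \<eta>"
    by (rule smooth_near_cong[OF smooth_near_const[of _ 0] V]; simp add: d_def \<eta>_def eq)+
  have "v (\<lambda>q. \<eta> q * d q) = \<eta> p * v d + d p * v \<eta>"
    by (rule tangent_mult[OF v \<eta> d])
  moreover have "(\<lambda>q. \<eta> q * d q) = d" "\<eta> p = 0" "d p = 0"
    using V eq by (auto simp: \<eta>_def d_def)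
  ultimately have "v d = 0" by simp
  moreover have "v f = v k + v d"
    using tangent_add[OF v k d] by (simp add: d_def)
  ultimately show ?thesis by simp
qed

lemma tangent_locally_const:
  assumes "v \<in> tangent_space A p" "open V" "p \<in> V" "\<And>q. q \<in> V \<Longrightarrow> f q = c"
  shows "v f = 0"
  using tangent_cong[OF assms(1) smooth_near_const assms(2,3), of c f] assms(4)
    tangent_const[OF assms(1)] by simp

text \<open>Since tangent vectors are only known to be derivations, the chain rule for the logarithm
  is obtained from the factorization \<open>ln (1 + x) = x S(x)\<close> with \<open>S\<close> smooth and \<open>S(0) = 1\<close>.\<close>

lemma tangent_ln:
  assumes v: "v \<in> tangent_space A p" and F: "smooth_fun_on A V F" and p: "p \<in> V"
    and pos: "\<And>q. q \<in> V \<Longrightarrow> 0 < F q"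
  shows "v (\<lambda>q. ln (F q)) = v F / F p"
proof -
  obtain S :: "real \<Rightarrow> real" where S: "smooth_on (ball 0 1) S" "S 0 = 1"
    "\<And>x. x \<in> ball 0 1 \<Longrightarrow> ln (1 + x) = x * S x"
    using ln_one_plus_factor by blast
  \<comment> \<open>\<open>K\<close> is F / F(p) - 1, so that ln F = ln F(p) + ln(1 + K) and K(p) =
    0. On \<open>W\<close> the factorization applies, and in the Leibniz rule for K S(K) at p only
    S(0) v(K) = v(K) survives.\<close>
  define K where "K = (\<lambda>q. 1 / F p * F q + (- 1))"
  have V: "open V" using F by (rule smooth_fun_on_open)
  have Kp: "K p = 0" using pos[OF p] by (simp add: K_def)
  have K: "smooth_fun_on A V K"
    unfolding K_def by (intro smooth_fun_on_add smooth_fun_on_cmult smooth_fun_on_const F V)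
  define W where "W = V \<inter> K -` ball 0 1"
  have W: "open W"
    unfolding W_def using smooth_fun_on_continuous[OF K] V by (simp add: continuous_open_preimage)
  have pW: "p \<in> W" using p Kp by (simp add: W_def)
  have KW: "smooth_fun_on A W K"
    by (rule smooth_fun_on_subset[OF K W]) (auto simp: W_def)
  have SK: "smooth_fun_on A W (\<lambda>q. S (K q))"
    by (rule smooth_fun_on_compose_real[OF KW S(1)]) (auto simp: W_def)
  have Fn: "smooth_near A p F" by (rule smooth_nearI[OF F p])
  have eq: "ln (F p) + K q * S (K q) = ln (F q)" if "q \<in> W" for q
  proof -
    have "0 < F q" "K q \<in> ball 0 1" using that pos by (auto simp: W_def)
    then have "K q * S (K q) = ln (F q / F p)"
      using S(3)[of "K q"] by (simp add: K_def)
    then show ?thesis using \<open>0 < F q\<close> pos[OF p] by (simp add: ln_div)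
  qed
  note n = smooth_nearI[OF KW pW] smooth_nearI[OF SK pW]
  have "v (\<lambda>q. ln (F q)) = v (\<lambda>q. ln (F p) + K q * S (K q))"
    by (rule tangent_cong[OF v _ W pW eq, symmetric]) (intro smooth_near_add smooth_near_const smooth_near_mult n)
  also have "\<dots> = v (\<lambda>q. K q * S (K q))"
    by (subst tangent_add[OF v smooth_near_const smooth_near_mult[OF n]]) (simp add: tangent_const[OF v])
  also have "\<dots> = v K"
    by (subst tangent_mult[OF v n]) (simp add: Kp S(2))
  also have "\<dots> = v F / F p"
    unfolding K_def
    by (simp only: tangent_add[OF v smooth_near_cmult[OF Fn] smooth_near_const]
        tangent_const[OF v] tangent_cmult[OF v Fn]) simp
  finally show ?thesis .
qed

section \<open>Linear algebra on tangent spaces\<close>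

lemma tangent_space_comb:
  assumes "u \<in> tangent_space A p" "v \<in> tangent_space A p"
  shows "(\<lambda>f. \<alpha> * u f + \<beta> * v f) \<in> tangent_space A p"
  using assms unfolding tangent_space_def by (simp add: algebra_simps)

lemma tangent_space_zero: "(\<lambda>f. 0) \<in> tangent_space A p"
  by (simp add: tangent_space_def)

lemma tangent_space_sum:
  assumes "\<And>i. i \<in> I \<Longrightarrow> u i \<in> tangent_space A p"
  shows "(\<lambda>f. \<Sum>i\<in>I. c i * u i f) \<in> tangent_space A p"
  using assms
proof (induction I rule: infinite_finite_induct)
  case (insert i I)
  then show ?case using tangent_space_comb[of "u i" p "\<lambda>f. \<Sum>i\<in>I. c i * u i f" "c i" 1] by simp
qed (auto simp: tangent_space_zero)

lemma tangent_space_diff: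
  "u \<in> tangent_space A p \<Longrightarrow> v \<in> tangent_space A p \<Longrightarrow> (\<lambda>f. u f - v f) \<in> tangent_space A p"
  using tangent_space_comb[of u p v 1 "-1"] by simp

lemma tangent_linearD:
  "tangent_linear A p L \<Longrightarrow> u \<in> tangent_space A p \<Longrightarrow> v \<in> tangent_space A p \<Longrightarrow>
    L (\<lambda>f. \<alpha> * u f + \<beta> * v f) = \<alpha> * L u + \<beta> * L v"
  by (simp add: tangent_linear_def)

lemma tangent_linear_zero: "tangent_linear A p L \<Longrightarrow> L (\<lambda>f. 0) = 0"
  using tangent_linearD[OF _ tangent_space_zero tangent_space_zero, of p L 0 0] by simp

lemma tangent_linear_sum:
  assumes "tangent_linear A p L" "\<And>i. i \<in> I \<Longrightarrow> u i \<in> tangent_space A p"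
  shows "L (\<lambda>f. \<Sum>i\<in>I. c i * u i f) = (\<Sum>i\<in>I. c i * L (u i))"
  using assms(2)
proof (induction I rule: infinite_finite_induct)
  case (insert i I)
  have "(\<lambda>f. \<Sum>i\<in>I. c i * u i f) \<in> tangent_space A p"
    using insert.prems by (intro tangent_space_sum) auto
  then have "L (\<lambda>f. c i * u i f + 1 * (\<Sum>i\<in>I. c i * u i f))
      = c i * L (u i) + 1 * L (\<lambda>f. \<Sum>i\<in>I. c i * u i f)"
    using insert.prems by (intro tangent_linearD[OF assms(1)]) auto
  then show ?case using insert by simp
qed (use tangent_linear_zero[OF assms(1)] in auto)

lemma tangent_linear_diff:
  assumes "tangent_linear A p L" "u \<in> tangent_space A p" "v \<in> tangent_space A p"
  shows "L (\<lambda>f. u f - v f) = L u - L v"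
  using tangent_linearD[OF assms, of 1 "-1"] by simp

text \<open>Linearity is tested on tangent vectors only, and these are closed under combinations.
  Objects defined by \<open>THE\<close>, whose values are computed only on tangent vectors, thus
  inherit linearity from an explicit formula; \<open>tangent_bilinear_cong\<close> plays the same
  role.\<close>

lemma tangent_linear_cong:
  assumes "tangent_linear A p L" and eq: "\<And>u. u \<in> tangent_space A p \<Longrightarrow> L u = L' u"
  shows "tangent_linear A p L'"
  using assms(1) unfolding tangent_linear_def by (simp add: tangent_space_comb flip: eq)

lemma tangent_linear_cmult: "tangent_linear A p L \<Longrightarrow> tangent_linear A p (\<lambda>u. c * L u)"
  by (simp add: tangent_linear_def algebra_simps)

lemma tangent_linear_sum_fun:
  assumes "\<And>i. i \<in> I \<Longrightarrow> tangent_linear A p (L i)"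
  shows "tangent_linear A p (\<lambda>u. \<Sum>i\<in>I. L i u)"
  using assms by (simp add: tangent_linear_def sum.distrib sum_distrib_left)

lemma tangent_bilinearD:
  assumes "tangent_bilinear A p B" "u \<in> tangent_space A p"
  shows "tangent_linear A p (B u)" "tangent_linear A p (\<lambda>v. B v u)"
  using assms by (auto simp: tangent_bilinear_def)

lemma tangent_bilinear_cong:
  assumes "tangent_bilinear A p B"
    and eq: "\<And>u v. u \<in> tangent_space A p \<Longrightarrow> v \<in> tangent_space A p \<Longrightarrow> B u v = B' u v"
  shows "tangent_bilinear A p B'"
  using assms(1) unfolding tangent_bilinear_def tangent_linear_def
  by (simp add: tangent_space_comb flip: eq)

lemma tangent_bilinear_mult:
  "tangent_linear A p L \<Longrightarrow> tangent_linear A p M \<Longrightarrow> tangent_bilinear A p (\<lambda>u v. L u * M v)"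
  by (simp add: tangent_bilinear_def tangent_linear_def algebra_simps)

lemma tangent_bilinear_sum:
  assumes "\<And>i. i \<in> I \<Longrightarrow> tangent_bilinear A p (B i)"
  shows "tangent_bilinear A p (\<lambda>u v. \<Sum>i\<in>I. B i u v)"
  using assms by (simp add: tangent_bilinear_def tangent_linear_sum_fun)

section \<open>Vector fields on open sets\<close>

lemma vector_fieldD:
  assumes "vector_field A U X"
  shows "open U" "q \<in> U \<Longrightarrow> X q \<in> tangent_space A q"
    "smooth_fun_on A V f \<Longrightarrow> V \<subseteq> U \<Longrightarrow> smooth_fun_on A V (\<lambda>q. X q f)"
  using assms by (auto simp: vector_field_def)

lemma vector_field_subset: "vector_field A U X \<Longrightarrow> open V \<Longrightarrow> V \<subseteq> U \<Longrightarrow> vector_field A V X"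
  unfolding vector_field_def by blast

lemma vector_field_cong:
  assumes "vector_field A U X" "\<And>q. q \<in> U \<Longrightarrow> X q = Y q"
  shows "vector_field A U Y"
proof -
  have "smooth_fun_on A V (\<lambda>q. Y q f)" if "V \<subseteq> U" "smooth_fun_on A V f" for V f
    by (rule smooth_fun_on_cong[OF vector_fieldD(3)[OF assms(1) that(2,1)]])
       (use assms(2) that in auto)
  then show ?thesis
    using assms by (auto simp: vector_field_def)
qed

lemma vector_field_sum:
  assumes "open U" "\<And>i. i \<in> I \<Longrightarrow> vector_field A U (X i)" "\<And>i. i \<in> I \<Longrightarrow> smooth_fun_on A U (c i)"
  shows "vector_field A U (\<lambda>q f. \<Sum>i\<in>I. c i q * X i q f)"
  unfolding vector_field_def
proof (intro conjI allI impI ballI)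
  show "(\<lambda>f. \<Sum>i\<in>I. c i q * X i q f) \<in> tangent_space A q" if "q \<in> U" for q
    using assms(2) that by (intro tangent_space_sum vector_fieldD(2)) auto
  show "smooth_fun_on A V (\<lambda>q. \<Sum>i\<in>I. c i q * X i q f)" if "V \<subseteq> U" "smooth_fun_on A V f" for V f
    using assms that smooth_fun_on_open[OF that(2)]
    by (intro smooth_fun_on_sum smooth_fun_on_mult) (auto intro: smooth_fun_on_subset vector_fieldD(3))
qed (rule assms(1))

end

section \<open>Orthonormal bases\<close>

text \<open>This is the Laplace expansion along the first two columns: 2x2 minors times
  complementary minors. It matches the Hodge star on 2-forms, where two slots of the volume form are
  contracted and two remain.\<close>

lemma det_4:
  "det (M :: 'a::comm_ring_1^4^4) =
    (M$1$1 * M$2$2 - M$2$1 * M$1$2) * (M$3$3 * M$4$4 - M$4$3 * M$3$4)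
  - (M$1$1 * M$3$2 - M$3$1 * M$1$2) * (M$2$3 * M$4$4 - M$4$3 * M$2$4)
  + (M$1$1 * M$4$2 - M$4$1 * M$1$2) * (M$2$3 * M$3$4 - M$3$3 * M$2$4)
  + (M$2$1 * M$3$2 - M$3$1 * M$2$2) * (M$1$3 * M$4$4 - M$4$3 * M$1$4)
  - (M$2$1 * M$4$2 - M$4$1 * M$2$2) * (M$1$3 * M$3$4 - M$3$3 * M$1$4)
  + (M$3$1 * M$4$2 - M$4$1 * M$3$2) * (M$1$3 * M$2$4 - M$2$3 * M$1$4)"
proof -
  have f1234: "finite {2::4, 3, 4}" "1 \<notin> {2::4, 3, 4}"
    and f234: "finite {3::4, 4}" "2 \<notin> {3::4, 4}"
    and f34: "finite {4::4}" "3 \<notin> {4::4}"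
    by auto
  show ?thesis
    unfolding det_def UNIV_4
    unfolding sum_over_permutations_insert[OF f1234]
    unfolding sum_over_permutations_insert[OF f234]
    unfolding sum_over_permutations_insert[OF f34]
    unfolding permutes_sing
    by (simp add: sign_swap_id permutation_swap_id permutation_compose sign_compose sign_id swap_id_eq algebra_simps)
qed

locale riemannian_manifold = oriented_manifold A
  for A :: "('m::{t2_space, second_countable_topology}, 'n::finite) atlas" +
  fixes g :: "'m bilin_field"
  assumes metric: "riemannian_metric A g"
begin

lemma metric_sym: "u \<in> tangent_space A p \<Longrightarrow> v \<in> tangent_space A p \<Longrightarrow> g p u v = g p v u"
  using metric by (auto simp: riemannian_metric_def)

lemma metric_bilinear: "tangent_bilinear A p (g p)"
  using metric by (auto simp: riemannian_metric_def smooth_bilin_field_def)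

lemma metric_smooth:
  "vector_field A U X \<Longrightarrow> vector_field A U Y \<Longrightarrow> smooth_fun_on A U (\<lambda>p. g p (X p) (Y p))"
  using metric by (auto simp: riemannian_metric_def smooth_bilin_field_def)

lemma onb_tangent: "orthonormal_basis A g p e \<Longrightarrow> e i \<in> tangent_space A p"
  by (simp add: orthonormal_basis_def tangent_basis_def)

lemma onb_metric: "orthonormal_basis A g p e \<Longrightarrow> g p (e i) (e j) = (if i = j then 1 else 0)"
  by (simp add: orthonormal_basis_def)

lemma onb_metric_sum:
  assumes e: "orthonormal_basis A g p e"
  shows "g p (\<lambda>f. \<Sum>i\<in>I. c i * e i f) (e j) = (if j \<in> I then c j else 0)"
proof -
  have "g p (\<lambda>f. \<Sum>i\<in>I. c i * e i f) (e j) = (\<Sum>i\<in>I. c i * g p (e i) (e j))"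
    by (rule tangent_linear_sum[where L = "\<lambda>v. g p v (e j)",
          OF tangent_bilinearD(2)[OF metric_bilinear onb_tangent[OF e]] onb_tangent[OF e]])
  then show ?thesis by (simp add: onb_metric[OF e] if_distrib cong: if_cong)
qed

lemma onb_expand:
  assumes e: "orthonormal_basis A g p e" and u: "u \<in> tangent_space A p"
  shows "u = (\<lambda>f. \<Sum>i\<in>UNIV. g p u (e i) * e i f)"
proof -
  obtain c where c: "u = (\<lambda>f. \<Sum>i\<in>UNIV. c i * e i f)"
    using e u by (auto simp: orthonormal_basis_def tangent_basis_def)
  then have "g p u (e j) = c j" for j using onb_metric_sum[OF e, where I = UNIV and c = c and j = j] by simp
  with c show ?thesis by simp
qed

lemma onb_linear:
  assumes e: "orthonormal_basis A g p e" and u: "u \<in> tangent_space A p" and L: "tangent_linear A p L"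
  shows "L u = (\<Sum>i\<in>UNIV. g p u (e i) * L (e i))"
proof -
  have "L u = L (\<lambda>f. \<Sum>i\<in>UNIV. g p u (e i) * e i f)"
    by (rule arg_cong[OF onb_expand[OF e u]])
  also have "\<dots> = (\<Sum>i\<in>UNIV. g p u (e i) * L (e i))"
    by (rule tangent_linear_sum[OF L onb_tangent[OF e]])
  finally show ?thesis .
qed

lemma onb_bilinear:
  assumes e: "orthonormal_basis A g p e" and B: "tangent_bilinear A p B"
    and u: "u \<in> tangent_space A p" and v: "v \<in> tangent_space A p"
  shows "B u v = (\<Sum>i\<in>UNIV. \<Sum>j\<in>UNIV. g p u (e i) * g p v (e j) * B (e i) (e j))"
proof -
  have "B u v = (\<Sum>i\<in>UNIV. g p u (e i) * B (e i) v)"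
    by (rule onb_linear[OF e u tangent_bilinearD(2)[OF B v]])
  also have "\<dots> = (\<Sum>i\<in>UNIV. \<Sum>j\<in>UNIV. g p u (e i) * g p v (e j) * B (e i) (e j))"
    by (subst onb_linear[OF e v tangent_bilinearD(1)[OF B onb_tangent[OF e]]])
       (simp add: sum_distrib_left mult.assoc)
  finally show ?thesis .
qed

section \<open>Traces do not depend on the orthonormal basis\<close>

lemma onb_parseval:
  assumes e: "orthonormal_basis A g p e"
    and u: "u \<in> tangent_space A p" and v: "v \<in> tangent_space A p"
  shows "g p u v = (\<Sum>i\<in>UNIV. g p u (e i) * g p v (e i))"
  using onb_linear[OF e u tangent_bilinearD(2)[OF metric_bilinear v]] metric_sym[OF v onb_tangent[OF e]]
  by simp

text \<open>The matrix relating two orthonormal bases is orthogonal: expanding g(e_j, e_k) in the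
  basis \<open>b\<close> gives the relation \<open>orth\<close>, which collapses the double sum.
  This is the source of well-definedness for the metric trace, the norms and the Hodge star.\<close>

lemma onb_trace:
  assumes b: "orthonormal_basis A g p b" and e: "orthonormal_basis A g p e"
    and B: "tangent_bilinear A p B"
  shows "(\<Sum>i\<in>UNIV. B (b i) (b i)) = (\<Sum>i\<in>UNIV. B (e i) (e i))"
proof -
  have orth: "(\<Sum>i\<in>UNIV. g p (b i) (e j) * g p (b i) (e k)) = of_bool (j = k)" for j k
    using onb_parseval[OF b onb_tangent[OF e] onb_tangent[OF e], of j k]
    by (simp only: metric_sym[OF onb_tangent[OF b] onb_tangent[OF e]] onb_metric[OF e] of_bool_def)
  have "(\<Sum>i\<in>UNIV. B (b i) (b i))
      = (\<Sum>i\<in>UNIV. \<Sum>j\<in>UNIV. \<Sum>k\<in>UNIV. g p (b i) (e j) * g p (b i) (e k) * B (e j) (e k))"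
    by (intro sum.cong refl onb_bilinear[OF e B] onb_tangent[OF b])
  also have "\<dots> = (\<Sum>j\<in>UNIV. \<Sum>i\<in>UNIV. \<Sum>k\<in>UNIV. g p (b i) (e j) * g p (b i) (e k) * B (e j) (e k))"
    by (rule sum.swap)
  also have "\<dots> = (\<Sum>j\<in>UNIV. \<Sum>k\<in>UNIV. \<Sum>i\<in>UNIV. g p (b i) (e j) * g p (b i) (e k) * B (e j) (e k))"
    by (intro sum.cong refl sum.swap)
  also have "\<dots> = (\<Sum>j\<in>UNIV. \<Sum>k\<in>UNIV. of_bool (j = k) * B (e j) (e k))"
    by (simp only: orth flip: sum_distrib_right)
  also have "\<dots> = (\<Sum>i\<in>UNIV. B (e i) (e i))"
    by simp
  finally show ?thesis .
qed

lemma metric_trace_eq: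
  assumes e: "orthonormal_basis A g p e" and B: "tangent_bilinear A p B"
  shows "metric_trace A g p B = (\<Sum>i\<in>UNIV. B (e i) (e i))"
  unfolding metric_trace_def
proof (rule the_equality)
  show "\<forall>b. orthonormal_basis A g p b \<longrightarrow> (\<Sum>i\<in>UNIV. B (e i) (e i)) = (\<Sum>i\<in>UNIV. B (b i) (b i))"
    using onb_trace[OF _ e B] by metis
qed (use e in blast)

text \<open>A sum over pairs of basis vectors in which each vector occurs twice is an iterated
  trace. Separating the two occurrences of each vector into different arguments of \<open>Q\<close>
  lets \<open>onb_trace\<close> change the basis one index at a time.\<close>

lemma onb_trace2:
  assumes b: "orthonormal_basis A g p b" and e: "orthonormal_basis A g p e"
    and l: "\<And>y. y \<in> tangent_space A p \<Longrightarrow> tangent_bilinear A p (\<lambda>x x'. Q x x' y y)"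
    and r: "\<And>x. x \<in> tangent_space A p \<Longrightarrow> tangent_bilinear A p (Q x x)"
  shows "(\<Sum>i\<in>UNIV. \<Sum>j\<in>UNIV. Q (b i) (b i) (b j) (b j))
    = (\<Sum>i\<in>UNIV. \<Sum>j\<in>UNIV. Q (e i) (e i) (e j) (e j))"
proof -
  have "(\<Sum>i\<in>UNIV. \<Sum>j\<in>UNIV. Q (b i) (b i) (b j) (b j))
      = (\<Sum>i\<in>UNIV. \<Sum>j\<in>UNIV. Q (b i) (b i) (e j) (e j))"
    by (intro sum.cong refl onb_trace[OF b e, where B = "Q (b i) (b i)" for i] r onb_tangent[OF b])
  also have "\<dots> = (\<Sum>j\<in>UNIV. \<Sum>i\<in>UNIV. Q (b i) (b i) (e j) (e j))"
    by (rule sum.swap)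
  also have "\<dots> = (\<Sum>j\<in>UNIV. \<Sum>i\<in>UNIV. Q (e i) (e i) (e j) (e j))"
    by (intro sum.cong refl onb_trace[OF b e, where B = "\<lambda>x x'. Q x x' (e j) (e j)" for j] l
        onb_tangent[OF e])
  also have "\<dots> = (\<Sum>i\<in>UNIV. \<Sum>j\<in>UNIV. Q (e i) (e i) (e j) (e j))"
    by (rule sum.swap)
  finally show ?thesis .
qed

lemma onb_trace3:
  assumes b: "orthonormal_basis A g p b" and e: "orthonormal_basis A g p e"
    and 1: "\<And>y z. y \<in> tangent_space A p \<Longrightarrow> z \<in> tangent_space A p \<Longrightarrow>
      tangent_bilinear A p (\<lambda>x x'. Q x x' y y z z)"
    and 2: "\<And>x z. x \<in> tangent_space A p \<Longrightarrow> z \<in> tangent_space A p \<Longrightarrow>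
      tangent_bilinear A p (\<lambda>y y'. Q x x y y' z z)"
    and 3: "\<And>x y. x \<in> tangent_space A p \<Longrightarrow> y \<in> tangent_space A p \<Longrightarrow>
      tangent_bilinear A p (Q x x y y)"
  shows "(\<Sum>i\<in>UNIV. \<Sum>j\<in>UNIV. \<Sum>k\<in>UNIV. Q (b i) (b i) (b j) (b j) (b k) (b k))
    = (\<Sum>i\<in>UNIV. \<Sum>j\<in>UNIV. \<Sum>k\<in>UNIV. Q (e i) (e i) (e j) (e j) (e k) (e k))"
proof -
  have "(\<Sum>i\<in>UNIV. \<Sum>j\<in>UNIV. \<Sum>k\<in>UNIV. Q (b i) (b i) (b j) (b j) (b k) (b k))
      = (\<Sum>i\<in>UNIV. \<Sum>j\<in>UNIV. \<Sum>k\<in>UNIV. Q (b i) (b i) (b j) (b j) (e k) (e k))"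
    by (intro sum.cong refl onb_trace[OF b e, where B = "Q (b i) (b i) (b j) (b j)" for i j] 3
        onb_tangent[OF b])
  also have "\<dots> = (\<Sum>i\<in>UNIV. \<Sum>k\<in>UNIV. \<Sum>j\<in>UNIV. Q (b i) (b i) (b j) (b j) (e k) (e k))"
    by (intro sum.cong refl sum.swap)
  also have "\<dots> = (\<Sum>k\<in>UNIV. \<Sum>i\<in>UNIV. \<Sum>j\<in>UNIV. Q (b i) (b i) (b j) (b j) (e k) (e k))"
    by (rule sum.swap)
  also have "\<dots> = (\<Sum>k\<in>UNIV. \<Sum>i\<in>UNIV. \<Sum>j\<in>UNIV. Q (e i) (e i) (e j) (e j) (e k) (e k))"
    by (intro sum.cong refl onb_trace2[OF b e, where Q = "\<lambda>x x' y y'. Q x x' y y' (e k) (e k)" for k]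
        1 2 onb_tangent[OF e])
  also have "\<dots> = (\<Sum>i\<in>UNIV. \<Sum>k\<in>UNIV. \<Sum>j\<in>UNIV. Q (e i) (e i) (e j) (e j) (e k) (e k))"
    by (rule sum.swap)
  also have "\<dots> = (\<Sum>i\<in>UNIV. \<Sum>j\<in>UNIV. \<Sum>k\<in>UNIV. Q (e i) (e i) (e j) (e j) (e k) (e k))"
    by (intro sum.cong refl sum.swap)
  finally show ?thesis .
qed

lemma bilin_norm_sq_eq:
  assumes e: "orthonormal_basis A g p e"
    and l: "\<And>u. u \<in> tangent_space A p \<Longrightarrow> tangent_bilinear A p (\<lambda>v v'. g p (B v u) (B v' u))"
    and r: "\<And>u. u \<in> tangent_space A p \<Longrightarrow> tangent_bilinear A p (\<lambda>v v'. g p (B u v) (B u v'))"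
  shows "bilin_norm_sq A g p B = (\<Sum>i\<in>UNIV. \<Sum>j\<in>UNIV. g p (B (e i) (e j)) (B (e i) (e j)))"
  unfolding bilin_norm_sq_def tangent_norm_sq_def
proof (rule the_equality)
  show "\<forall>b. orthonormal_basis A g p b \<longrightarrow>
      (\<Sum>i\<in>UNIV. \<Sum>j\<in>UNIV. g p (B (e i) (e j)) (B (e i) (e j)))
    = (\<Sum>i\<in>UNIV. \<Sum>j\<in>UNIV. g p (B (b i) (b j)) (B (b i) (b j)))"
    using onb_trace2[OF e, where Q = "\<lambda>x x' y y'. g p (B x y) (B x' y')", OF _ l r] by blast
qed (use e in blast)

lemma onb_metric_sums:
  assumes e: "orthonormal_basis A g p e"
  shows "g p (\<lambda>f. \<Sum>i\<in>I. c i * e i f) (\<lambda>f. \<Sum>i\<in>I. d i * e i f) = (\<Sum>i\<in>I. c i * d i)"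
proof -
  have "g p (\<lambda>f. \<Sum>i\<in>I. c i * e i f) (\<lambda>f. \<Sum>i\<in>I. d i * e i f)
      = (\<Sum>i\<in>I. d i * g p (\<lambda>f. \<Sum>i\<in>I. c i * e i f) (e i))"
    by (rule tangent_linear_sum[OF tangent_bilinearD(1)[OF metric_bilinear tangent_space_sum]
          onb_tangent[OF e]]) (rule onb_tangent[OF e])
  also have "\<dots> = (\<Sum>i\<in>I. c i * d i)"
    by (intro sum.cong refl) (simp add: onb_metric_sum[OF e])
  finally show ?thesis .
qed

lemma tangent_linear_metric: "u \<in> tangent_space A p \<Longrightarrow> tangent_linear A p (\<lambda>v. g p v u)"
  by (rule tangent_bilinearD(2)[OF metric_bilinear])

text \<open>Orthogonality gives det^2 = 1. For the sign, both bases are written in one chart around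
  \<open>p\<close>: the two coordinate matrices differ by the transpose of \<open>?O\<close> and
  both have positive determinant.\<close>

lemma det_onb_change:
  assumes b: "orthonormal_basis A g p b" "positive_basis A p b"
    and e: "orthonormal_basis A g p e" "positive_basis A p e"
  shows "det (\<chi> i j. g p (b i) (e j)) = 1"
proof -
  let ?O = "\<chi> i j. g p (b i) (e j)"
  obtain D \<phi> where D: "(D, \<phi>) \<in> A" "p \<in> D" by (rule chart_at)
  let ?\<Phi> = "\<lambda>b. \<chi> i j. b j (\<lambda>q. \<phi> q $ i) :: real^'n^'n"
  have "?O ** transpose ?O = mat 1"
    by (simp add: matrix_matrix_mult_def transpose_def mat_def onb_metric[OF b(1)]
        flip: onb_parseval[OF e(1) onb_tangent[OF b(1)] onb_tangent[OF b(1)]])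
  then have "det ?O * det (transpose ?O) = 1"
    using det_mul[of ?O "transpose ?O"] det_I by metis
  then have "det ?O * det ?O = 1" by (simp only: det_transpose)
  moreover have "0 < det ?O"
  proof -
    have "b j f = (\<Sum>k\<in>UNIV. e k f * g p (b j) (e k))" for j f
      using fun_cong[OF onb_expand[OF e(1) onb_tangent[OF b(1)]], of j f] by (simp add: mult.commute)
    then have "?\<Phi> b = ?\<Phi> e ** transpose ?O"
      by (simp add: matrix_matrix_mult_def transpose_def vec_eq_iff)
    then have "det (?\<Phi> b) = det (?\<Phi> e) * det (transpose ?O)"
      by (simp only: det_mul)
    then have "det (?\<Phi> b) = det (?\<Phi> e) * det ?O" by (simp only: det_transpose)
    moreover have "0 < det (?\<Phi> b)" "0 < det (?\<Phi> e)"
      using b(2) e(2) D by (auto simp: positive_basis_def)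
    ultimately show ?thesis by (simp add: zero_less_mult_iff)
  qed
  ultimately show ?thesis by (simp add: square_eq_1_iff)
qed

lemma volume_form_eq:
  assumes e: "orthonormal_basis A g p e" "positive_basis A p e"
    and v: "\<And>j. v j \<in> tangent_space A p"
  shows "volume_form A g p v = det (\<chi> i j. g p (e i) (v j))"
  unfolding volume_form_def
proof (rule the_equality)
  show "\<forall>b. orthonormal_basis A g p b \<longrightarrow> positive_basis A p b \<longrightarrow>
      det (\<chi> i j. g p (e i) (v j)) = det (\<chi> i j. g p (b i) (v j))"
  proof (intro allI impI)
    fix b assume b: "orthonormal_basis A g p b" "positive_basis A p b"
    have "(\<chi> i j. g p (b i) (v j)) = (\<chi> i j. g p (b i) (e j)) ** (\<chi> i j. g p (e i) (v j))"
      by (simp add: matrix_matrix_mult_def vec_eq_iff onb_parseval[OF e(1) onb_tangent[OF b(1)] v]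
          metric_sym[OF v onb_tangent[OF e(1)]])
    then show "det (\<chi> i j. g p (e i) (v j)) = det (\<chi> i j. g p (b i) (v j))"
      by (simp only: det_mul det_onb_change[OF b e] mult_1)
  qed
qed (use e in blast)

end

section \<open>The Levi-Civita connection in an orthonormal frame\<close>

locale levi_civita_frame = riemannian_manifold A g
  for A :: "('m::{t2_space, second_countable_topology}, 'n::finite) atlas" and g :: "'m bilin_field" +
  fixes nabla :: "'m connection" and U :: "'m set" and E :: "'n \<Rightarrow> 'm vfield"
    and \<gamma> :: "'n \<Rightarrow> 'n \<Rightarrow> 'n \<Rightarrow> 'm \<Rightarrow> real"
  assumes levi_civita: "levi_civita A g nabla"
    and open_U: "open U"
    and frame: "oriented_orthonormal_frame A g U E"
    and coefficients: "connection_coefficients U nabla E \<gamma>"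
begin

lemma frame_field: "vector_field A U (E i)"
  using frame by (simp add: oriented_orthonormal_frame_def)

lemma frame_onb: "q \<in> U \<Longrightarrow> orthonormal_basis A g q (\<lambda>i. E i q)"
  and frame_positive: "q \<in> U \<Longrightarrow> positive_basis A q (\<lambda>i. E i q)"
  using frame by (auto simp: oriented_orthonormal_frame_def)

lemma frame_tangent: "q \<in> U \<Longrightarrow> E i q \<in> tangent_space A q"
  by (rule vector_fieldD(2)[OF frame_field])

lemma frame_metric: "q \<in> U \<Longrightarrow> g q (E i q) (E j q) = (if i = j then 1 else 0)"
  by (rule onb_metric[OF frame_onb])

text \<open>Constant coefficients with respect to the frame extend a vector over all of
  \<open>U\<close>. This makes the universally quantified conditions in \<open>hessian\<close> and
  \<open>ext_deriv\<close> non-vacuous, hence their values unique.\<close>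

lemma frame_extension:
  assumes "p \<in> U" "u \<in> tangent_space A p"
  obtains X where "vector_field A U X" "X p = u" "extends A p u X"
proof -
  define X where "X = (\<lambda>q f. \<Sum>i\<in>UNIV. g p u (E i p) * E i q f)"
  have X: "vector_field A U X"
    unfolding X_def
    by (rule vector_field_sum[OF open_U frame_field smooth_fun_on_const[OF open_U]])
  moreover have "X p = u"
    unfolding X_def by (rule onb_expand[OF frame_onb[OF assms(1)] assms(2), symmetric])
  ultimately show thesis
    using assms(1) that[of X] unfolding extends_def by blast
qed

lemma nabla_field:
  "vector_field A V X \<Longrightarrow> vector_field A V Y \<Longrightarrow> vector_field A V (nabla X Y)"
  using levi_civita smooth_fun_on_const[of V 0] vector_fieldD(1)[of V X]
  unfolding levi_civita_def by blast

context
  fixes V :: "'m set" and X Y :: "'m vfield" and p :: 'm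
  assumes X: "vector_field A V X" and Y: "vector_field A V Y" and p: "p \<in> V"
begin

text \<open>The clauses of \<open>levi_civita\<close> are stated jointly for three fields and one
  function; the zero function fills that place in rules in which no function occurs.\<close>

private lemma const_smooth: "smooth_fun_on A V (\<lambda>q. 0)"
  by (rule smooth_fun_on_const[OF vector_fieldD(1)[OF X]])

lemma nabla_torsion_free: "lie A X Y p = (\<lambda>k. nabla X Y p k - nabla Y X p k)"
  using levi_civita[unfolded levi_civita_def, rule_format, OF X Y Y const_smooth] p by auto

lemma nabla_scale_left:
  "smooth_fun_on A V f \<Longrightarrow> nabla (\<lambda>q k. f q * X q k) Y p = (\<lambda>k. f p * nabla X Y p k)"
  using levi_civita[unfolded levi_civita_def, rule_format, OF X Y Y] p by auto

lemma nabla_scale_right: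
  "smooth_fun_on A V f \<Longrightarrow> nabla X (\<lambda>q k. f q * Y q k) p = (\<lambda>k. X p f * Y p k + f p * nabla X Y p k)"
  using levi_civita[unfolded levi_civita_def, rule_format, OF X Y Y] p by auto

lemma nabla_add_right:
  "vector_field A V Z \<Longrightarrow> nabla X (\<lambda>q k. Y q k + Z q k) p = (\<lambda>k. nabla X Y p k + nabla X Z p k)"
  using levi_civita[unfolded levi_civita_def, rule_format, OF X Y _ const_smooth] p by auto

lemma nabla_add_left:
  "vector_field A V Z \<Longrightarrow> nabla (\<lambda>q k. X q k + Y q k) Z p = (\<lambda>k. nabla X Z p k + nabla Y Z p k)"
  using levi_civita[unfolded levi_civita_def, rule_format, OF X Y _ const_smooth] p by auto

lemma nabla_metric:
  "vector_field A V Z \<Longrightarrow> X p (\<lambda>q. g q (Y q) (Z q)) = g p (nabla X Y p) (Z p) + g p (Y p) (nabla X Z p)"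
  using levi_civita[unfolded levi_civita_def, rule_format, OF X Y _ const_smooth] p by auto

end

lemma vector_field_zero: "open V \<Longrightarrow> vector_field A V (\<lambda>q f. 0)"
  using vector_field_sum[of V "{}"] by simp

lemma nabla_zero_left:
  assumes "vector_field A V X" "p \<in> V" shows "nabla (\<lambda>q k. 0) X p = (\<lambda>k. 0)"
  using nabla_scale_left[OF assms(1,1,2) smooth_fun_on_const[OF vector_fieldD(1)[OF assms(1)]], of 0]
  by simp

lemma nabla_zero_right:
  assumes "vector_field A V X" "p \<in> V" shows "nabla X (\<lambda>q k. 0) p = (\<lambda>k. 0)"
  using nabla_scale_right[OF assms(1,1,2) smooth_fun_on_const[OF vector_fieldD(1)[OF assms(1)]], of 0]
    tangent_const[OF vector_fieldD(2)[OF assms]]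
  by simp

text \<open>Locality, by the same indicator function argument as for tangent vectors.\<close>

lemma nabla_cong:
  assumes X: "vector_field A V X" and W: "vector_field A V W" and p: "p \<in> V"
    and eq: "\<And>q. q \<in> V \<Longrightarrow> W q = W' q"
  shows nabla_cong_right: "nabla X W p = nabla X W' p"
    and nabla_cong_left: "nabla W X p = nabla W' X p"
proof -
  have V: "open V" by (rule vector_fieldD(1)[OF X])
  define D where "D = (\<lambda>q k. W' q k - W q k)"
  define \<eta> :: "'m \<Rightarrow> real" where "\<eta> = (\<lambda>q. if q \<in> V then 0 else 1)"
  have D: "vector_field A V D"
    by (rule vector_field_cong[OF vector_field_zero[OF V]]) (simp add: D_def eq)
  have \<eta>: "smooth_fun_on A V \<eta>"
    by (rule smooth_fun_on_cong[OF smooth_fun_on_const[OF V, of 0]]) (simp add: \<eta>_def)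
  have \<eta>D: "(\<lambda>q k. \<eta> q * D q k) = D" and Dp: "D p = (\<lambda>k. 0)" and \<eta>p: "\<eta> p = 0"
    and W': "W' = (\<lambda>q k. W q k + D q k)"
    using p by (auto simp: \<eta>_def D_def eq fun_eq_iff)
  have "nabla X D p = (\<lambda>k. 0)"
    using nabla_scale_right[OF X D p \<eta>] unfolding \<eta>D Dp \<eta>p by simp
  then show "nabla X W p = nabla X W' p"
    unfolding W' nabla_add_right[OF X W p D] by simp
  have "nabla D X p = (\<lambda>k. 0)"
    using nabla_scale_left[OF D X p \<eta>] unfolding \<eta>D \<eta>p by simp
  then show "nabla W X p = nabla W' X p"
    unfolding W' nabla_add_left[OF W D p X] by simp
qed

lemma nabla_sum_right:
  assumes X: "vector_field A V X" and p: "p \<in> V"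
    and Y: "\<And>i. i \<in> I \<Longrightarrow> vector_field A V (Y i)" and c: "\<And>i. i \<in> I \<Longrightarrow> smooth_fun_on A V (c i)"
  shows "nabla X (\<lambda>q k. \<Sum>i\<in>I. c i q * Y i q k) p
    = (\<lambda>k. \<Sum>i\<in>I. X p (c i) * Y i p k + c i p * nabla X (Y i) p k)"
  using Y c
proof (induction I rule: infinite_finite_induct)
  case (insert i I)
  have V: "open V" by (rule vector_fieldD(1)[OF X])
  have 1: "vector_field A V (\<lambda>q k. \<Sum>i\<in>I. c i q * Y i q k)"
    using insert.prems by (intro vector_field_sum V) auto
  have 2: "vector_field A V (\<lambda>q k. c i q * Y i q k)"
    using vector_field_sum[OF V, of "{i}" Y c] insert.prems by simp
  have "nabla X (\<lambda>q k. c i q * Y i q k) p = (\<lambda>k. X p (c i) * Y i p k + c i p * nabla X (Y i) p k)"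
    using insert.prems by (intro nabla_scale_right[OF X _ p]) auto
  then show ?case
    using nabla_add_right[OF X 2 p 1] insert by simp
qed (use nabla_zero_right[OF X p] in auto)

lemma nabla_sum_left:
  assumes X: "vector_field A V X" and p: "p \<in> V"
    and Y: "\<And>i. i \<in> I \<Longrightarrow> vector_field A V (Y i)" and c: "\<And>i. i \<in> I \<Longrightarrow> smooth_fun_on A V (c i)"
  shows "nabla (\<lambda>q k. \<Sum>i\<in>I. c i q * Y i q k) X p = (\<lambda>k. \<Sum>i\<in>I. c i p * nabla (Y i) X p k)"
  using Y c
proof (induction I rule: infinite_finite_induct)
  case (insert i I)
  have V: "open V" by (rule vector_fieldD(1)[OF X])
  have 1: "vector_field A V (\<lambda>q k. \<Sum>i\<in>I. c i q * Y i q k)"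
    using insert.prems by (intro vector_field_sum V) auto
  have 2: "vector_field A V (\<lambda>q k. c i q * Y i q k)"
    using vector_field_sum[OF V, of "{i}" Y c] insert.prems by simp
  have "nabla (\<lambda>q k. c i q * Y i q k) X p = (\<lambda>k. c i p * nabla (Y i) X p k)"
    using insert.prems by (intro nabla_scale_left[OF _ X p]) auto
  then show ?case
    using nabla_add_left[OF 2 1 p X] insert by simp
qed (use nabla_zero_left[OF X p] in auto)

section \<open>Connection coefficients and curvature in the frame\<close>

lemma nabla_frame: "q \<in> U \<Longrightarrow> nabla (E i) (E j) q = (\<lambda>f. \<Sum>k\<in>UNIV. \<gamma> i j k q * E k q f)"
  using coefficients by (simp add: connection_coefficients_def)

lemma coefficient_eq: "q \<in> U \<Longrightarrow> \<gamma> i j k q = g q (nabla (E i) (E j) q) (E k q)"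
  using onb_metric_sum[OF frame_onb, where I = UNIV and c = "\<lambda>k. \<gamma> i j k q" and j = k] by (simp add: nabla_frame)

lemma coefficient_smooth: "smooth_fun_on A U (\<gamma> i j k)"
  by (rule smooth_fun_on_cong[OF metric_smooth[OF nabla_field[OF frame_field frame_field] frame_field]])
     (simp add: coefficient_eq)

text \<open>The functions g(E_j, E_k) are constant on \<open>U\<close>, so metric compatibility has
  left-hand side 0.\<close>

lemma coefficient_antisym:
  assumes "q \<in> U"
  shows "\<gamma> i j k q = - \<gamma> i k j q"
proof -
  have "E i q (\<lambda>q. g q (E j q) (E k q)) = 0"
    by (rule tangent_locally_const[OF frame_tangent[OF assms] open_U assms]) (rule frame_metric)
  then have "g q (nabla (E i) (E j) q) (E k q) + g q (E j q) (nabla (E i) (E k) q) = 0"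
    using nabla_metric[OF frame_field frame_field assms frame_field, of i j k] by simp
  then show ?thesis
    using metric_sym[OF frame_tangent[OF assms] vector_fieldD(2)[OF nabla_field[OF frame_field frame_field] assms]]
    by (simp add: coefficient_eq[OF assms])
qed

lemma lie_frame:
  "q \<in> U \<Longrightarrow> lie A (E i) (E j) q = (\<lambda>f. \<Sum>k\<in>UNIV. (\<gamma> i j k q - \<gamma> j i k q) * E k q f)"
  by (simp add: nabla_torsion_free[OF frame_field frame_field] nabla_frame left_diff_distrib sum_subtractf)

text \<open>The expansion of the inner derivative is known only on \<open>U\<close>, so it is
  inserted through locality of the connection; the Leibniz rule then differentiates the
  coefficients.\<close>

lemma nabla_frame_frame:
  assumes p: "p \<in> U"
  shows "nabla (E i) (nabla (E j) (E k)) p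
    = (\<lambda>f. \<Sum>l\<in>UNIV. (E i p (\<gamma> j k l) + (\<Sum>m\<in>UNIV. \<gamma> j k m p * \<gamma> i m l p)) * E l p f)"
proof -
  have "nabla (E i) (nabla (E j) (E k)) p = nabla (E i) (\<lambda>q f. \<Sum>l\<in>UNIV. \<gamma> j k l q * E l q f) p"
    by (rule nabla_cong_right[OF frame_field nabla_field[OF frame_field frame_field] p]) (rule nabla_frame)
  also have "\<dots> = (\<lambda>f. \<Sum>l\<in>UNIV. E i p (\<gamma> j k l) * E l p f + \<gamma> j k l p * nabla (E i) (E l) p f)"
    by (rule nabla_sum_right[OF frame_field p frame_field coefficient_smooth])
  also have "\<dots> = (\<lambda>f. \<Sum>l\<in>UNIV. (E i p (\<gamma> j k l) + (\<Sum>m\<in>UNIV. \<gamma> j k m p * \<gamma> i m l p)) * E l p f)"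
  proof
    fix f
    have "(\<Sum>l\<in>UNIV. \<gamma> j k l p * (\<Sum>m\<in>UNIV. \<gamma> i l m p * E m p f))
        = (\<Sum>m\<in>UNIV. \<Sum>l\<in>UNIV. \<gamma> j k l p * \<gamma> i l m p * E m p f)"
      by (subst sum.swap) (simp add: sum_distrib_left mult.assoc)
    then show "(\<Sum>l\<in>UNIV. E i p (\<gamma> j k l) * E l p f + \<gamma> j k l p * nabla (E i) (E l) p f)
        = (\<Sum>l\<in>UNIV. (E i p (\<gamma> j k l) + (\<Sum>m\<in>UNIV. \<gamma> j k m p * \<gamma> i m l p)) * E l p f)"
      by (simp add: nabla_frame[OF p] sum.distrib distrib_right sum_distrib_right)
  qed
  finally show ?thesis .
qed

text \<open>A general frame does not commute: besides the usual quadratic terms there is the bracket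
  term, with structure functions \<open>\<gamma> i j m - \<gamma> j i m\<close>, expanded by
  linearity over functions in the differentiating field.\<close>

lemma curvature_frame:
  assumes p: "p \<in> U"
  shows "curvature A nabla (E i) (E j) (E k) p = (\<lambda>f. \<Sum>l\<in>UNIV.
    (E i p (\<gamma> j k l) - E j p (\<gamma> i k l)
      + (\<Sum>m\<in>UNIV. \<gamma> j k m p * \<gamma> i m l p - \<gamma> i k m p * \<gamma> j m l p - (\<gamma> i j m p - \<gamma> j i m p) * \<gamma> m k l p))
    * E l p f)"
proof -
  have lie_field: "vector_field A U (lie A (E i) (E j))"
    by (rule vector_field_cong[OF vector_field_sum[where I = UNIV and X = E, OF open_U frame_field]])
       (use smooth_fun_on_diff[OF coefficient_smooth coefficient_smooth] in \<open>auto simp: lie_frame\<close>)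
  have "nabla (lie A (E i) (E j)) (E k) p
      = nabla (\<lambda>q f. \<Sum>m\<in>UNIV. (\<gamma> i j m q - \<gamma> j i m q) * E m q f) (E k) p"
    by (rule nabla_cong_left[OF frame_field lie_field p]) (rule lie_frame)
  also have "\<dots> = (\<lambda>f. \<Sum>m\<in>UNIV. (\<gamma> i j m p - \<gamma> j i m p) * nabla (E m) (E k) p f)"
    by (rule nabla_sum_left[OF frame_field p frame_field smooth_fun_on_diff[OF coefficient_smooth coefficient_smooth]])
  also have "\<dots> = (\<lambda>f. \<Sum>l\<in>UNIV. (\<Sum>m\<in>UNIV. (\<gamma> i j m p - \<gamma> j i m p) * \<gamma> m k l p) * E l p f)"
    unfolding nabla_frame[OF p] sum_distrib_left sum_distrib_right
    by (subst sum.swap) (simp add: mult.assoc)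
  finally have "nabla (lie A (E i) (E j)) (E k) p
      = (\<lambda>f. \<Sum>l\<in>UNIV. (\<Sum>m\<in>UNIV. (\<gamma> i j m p - \<gamma> j i m p) * \<gamma> m k l p) * E l p f)" .
  then show ?thesis
    unfolding curvature_def nabla_frame_frame[OF p]
    by (simp add: sum_subtractf sum.distrib algebra_simps)
qed

text \<open>For an orthonormal pair the denominator is 1. The differentiated coefficients are
  \<open>\<gamma> j j i\<close> and, up to sign, \<open>\<gamma> i i j\<close>: the same entries
  whose sums form the mean curvatures.\<close>

lemma sectional_curvature_frame:
  assumes p: "p \<in> U" and "i \<noteq> j"
  shows "sectional_curvature A g nabla (E i) (E j) p = E i p (\<gamma> j j i) - E j p (\<gamma> i j i)
    + (\<Sum>m\<in>UNIV. \<gamma> j j m p * \<gamma> i m i p - \<gamma> i j m p * \<gamma> j m i p - (\<gamma> i j m p - \<gamma> j i m p) * \<gamma> m j i p)"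
  using assms(2)
  by (simp add: sectional_curvature_def curvature_frame[OF p] onb_metric_sum[OF frame_onb[OF p]]
      frame_metric[OF p])

section \<open>Hessian and Laplacian at a critical point\<close>

lemma frame_expand_field:
  "q \<in> U \<Longrightarrow> u \<in> tangent_space A q \<Longrightarrow> u = (\<lambda>f. \<Sum>i\<in>UNIV. g q u (E i q) * E i q f)"
  by (rule onb_expand[OF frame_onb])

text \<open>At a critical point the connection term is a tangent vector applied to \<open>f\<close>,
  hence 0. Writing Y near p as a combination of the frame and applying the Leibniz rule, all terms
  that differentiate the coefficients of Y carry a factor E_i f(p) = 0. What remains depends only on
  \<open>u\<close> and \<open>v\<close>.\<close>

lemma hessian_critical:
  assumes p: "p \<in> U" and f: "smooth_fun_on A U f" and crit: "critical_point A f p"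
    and u: "u \<in> tangent_space A p" and v: "v \<in> tangent_space A p"
  shows "hessian A nabla f p u v = (\<Sum>i\<in>UNIV. g p v (E i p) * u (\<lambda>q. E i q f))"
proof -
  have ext: "X p (\<lambda>q. Y q f) - nabla X Y p f = (\<Sum>i\<in>UNIV. g p v (E i p) * u (\<lambda>q. E i q f))"
    if X: "extends A p u X" and Y: "extends A p v Y" for X Y
  proof -
    obtain V W where VW: "p \<in> V" "vector_field A V X" "p \<in> W" "vector_field A W Y"
      using X Y by (auto simp: extends_def)
    let ?N = "U \<inter> V \<inter> W"
    have o: "open ?N" using open_U VW by (auto dest: vector_fieldD(1))
    have pN: "p \<in> ?N" using p VW by simp
    have XN: "vector_field A ?N X" and YN: "vector_field A ?N Y"
      and EN: "vector_field A ?N (E i)" for i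
      using VW frame_field o by (blast intro: vector_field_subset)+
    have fN: "smooth_fun_on A ?N f" by (rule smooth_fun_on_subset[OF f o]) auto
    have "nabla X Y p f = 0"
      using crit vector_fieldD(2)[OF nabla_field[OF XN YN] pN] by (simp add: critical_point_def)
    moreover have "X p (\<lambda>q. Y q f) = (\<Sum>i\<in>UNIV. g p v (E i p) * u (\<lambda>q. E i q f))"
    proof -
      let ?y = "\<lambda>i q. g q (Y q) (E i q)"
      have n: "smooth_near A p (?y i)" "smooth_near A p (\<lambda>q. E i q f)" for i
        by (rule smooth_nearI[OF metric_smooth[OF YN EN] pN],
            rule smooth_nearI[OF vector_fieldD(3)[OF EN fN subset_refl] pN])
      have Xp: "X p = u" "Y p = v" "X p \<in> tangent_space A p"
        using X Y u by (auto simp: extends_def)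
      have Ef: "E i p f = 0" for i
        using crit frame_tangent[OF p] unfolding critical_point_def by blast
      have "X p (\<lambda>q. Y q f) = X p (\<lambda>q. \<Sum>i\<in>UNIV. ?y i q * E i q f)"
        by (rule tangent_cong[OF Xp(3) smooth_nearI[OF vector_fieldD(3)[OF YN fN subset_refl] pN] o pN])
           (use frame_expand_field vector_fieldD(2)[OF YN] in \<open>metis IntE\<close>)
      also have "\<dots> = (\<Sum>i\<in>UNIV. X p (\<lambda>q. ?y i q * E i q f))"
        by (intro tangent_sum[OF Xp(3)] smooth_near_mult n)
      also have "\<dots> = (\<Sum>i\<in>UNIV. g p v (E i p) * u (\<lambda>q. E i q f))"
        by (simp add: tangent_mult[OF u n] Xp(1,2) Ef)
      finally show ?thesis .
    qed
    ultimately show ?thesis by simp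
  qed
  obtain X Y where "extends A p u X" "extends A p v Y"
    using frame_extension[OF p] u v by metis
  then show ?thesis
    unfolding hessian_def using ext by (intro the_equality) auto
qed

lemma laplacian_critical:
  assumes p: "p \<in> U" and f: "smooth_fun_on A U f" and crit: "critical_point A f p"
  shows "laplacian A g nabla f p = - (\<Sum>i\<in>UNIV. E i p (\<lambda>q. E i q f))"
proof -
  let ?B = "\<lambda>u v. \<Sum>i\<in>UNIV. g p v (E i p) * u (\<lambda>q. E i q f)"
  have "tangent_bilinear A p ?B"
    unfolding tangent_bilinear_def tangent_linear_def
    by (simp add: tangent_linearD[OF tangent_linear_metric[OF frame_tangent[OF p]]] algebra_simps
        sum.distrib sum_distrib_left)
  then have "tangent_bilinear A p (hessian A nabla f p)"
    by (rule tangent_bilinear_cong) (simp add: hessian_critical[OF p f crit])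
  then have "laplacian A g nabla f p = - (\<Sum>i\<in>UNIV. hessian A nabla f p (E i p) (E i p))"
    unfolding laplacian_def by (simp add: metric_trace_eq[OF frame_onb[OF p]])
  also have "\<dots> = - (\<Sum>i\<in>UNIV. E i p (\<lambda>q. E i q f))"
    by (simp add: hessian_critical[OF p f crit frame_tangent[OF p] frame_tangent[OF p]]
        frame_metric[OF p] if_distrib[of "\<lambda>x. x * _"] cong: if_cong)
  finally show ?thesis .
qed

end

section \<open>Exterior derivatives of 2-forms in a frame\<close>

text \<open>A version of \<open>two_form\<close> over \<open>U\<close>: the Hodge star of
  \<open>h\<close> is computed only where the frame exists, yet its exterior derivative is needed
  there.\<close>

definition two_form_on ::
  "('m::topological_space, 'n::finite) atlas \<Rightarrow> 'm set \<Rightarrow> 'm bilin_field \<Rightarrow> bool" where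
  "two_form_on A U \<eta> \<longleftrightarrow>
     (\<forall>q\<in>U. tangent_bilinear A q (\<eta> q) \<and>
       (\<forall>u\<in>tangent_space A q. \<forall>v\<in>tangent_space A q. \<eta> q u v = - \<eta> q v u)) \<and>
     (\<forall>V X Y. V \<subseteq> U \<longrightarrow> vector_field A V X \<longrightarrow> vector_field A V Y \<longrightarrow>
       smooth_fun_on A V (\<lambda>q. \<eta> q (X q) (Y q)))"

text \<open>The invariant formula for the exterior derivative, with actual fields as arguments; that
  it depends only on their values at \<open>p\<close> is the content of
  \<open>field_deriv_expand\<close>.\<close>

definition field_deriv ::
  "('m::topological_space, 'n::finite) atlas \<Rightarrow> 'm bilin_field \<Rightarrow>
   'm vfield \<Rightarrow> 'm vfield \<Rightarrow> 'm vfield \<Rightarrow> 'm \<Rightarrow> real" where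
  "field_deriv A \<eta> X Y Z p =
     X p (\<lambda>q. \<eta> q (Y q) (Z q)) - Y p (\<lambda>q. \<eta> q (X q) (Z q)) + Z p (\<lambda>q. \<eta> q (X q) (Y q))
     - \<eta> p (lie A X Y p) (Z p) + \<eta> p (lie A X Z p) (Y p) - \<eta> p (lie A Y Z p) (X p)"

context levi_civita_frame
begin

lemma lie_tangent:
  assumes "vector_field A V X" "vector_field A V Y" "p \<in> V"
  shows "lie A X Y p \<in> tangent_space A p"
  unfolding nabla_torsion_free[OF assms]
  by (rule tangent_space_diff; rule vector_fieldD(2)[OF nabla_field assms(3)]) (rule assms)+

lemma lie_swap: "lie A Y X p = (\<lambda>f. - lie A X Y p f)"
  by (auto simp: lie_def)

text \<open>The bracket is not linear over functions: each coefficient of X contributes a derivative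
  along Y. Writing the bracket as a difference of covariant derivatives obtains this from locality
  and the sum rules of the connection.\<close>

lemma lie_frame_expand:
  assumes X: "vector_field A V X" and Y: "vector_field A V Y" and p: "p \<in> V" and V: "V \<subseteq> U"
  shows "lie A X Y p = (\<lambda>f. (\<Sum>i\<in>UNIV. g p (X p) (E i p) * lie A (E i) Y p f)
    - (\<Sum>i\<in>UNIV. Y p (\<lambda>q. g q (X q) (E i q)) * E i p f))"
proof -
  have E: "vector_field A V (E i)" for i
    by (rule vector_field_subset[OF frame_field vector_fieldD(1)[OF X] V])
  have eq: "X q = (\<lambda>f. \<Sum>i\<in>UNIV. g q (X q) (E i q) * E i q f)" if "q \<in> V" for q
    using frame_expand_field[OF _ vector_fieldD(2)[OF X that]] V that by blast
  have x: "smooth_fun_on A V (\<lambda>q. g q (X q) (E i q))" for i by (rule metric_smooth[OF X E])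
  have "nabla X Y p = (\<lambda>f. \<Sum>i\<in>UNIV. g p (X p) (E i p) * nabla (E i) Y p f)"
    by (rule trans[OF nabla_cong_left[OF Y X p eq] nabla_sum_left[OF Y p E x]])
  moreover have "nabla Y X p
      = (\<lambda>f. \<Sum>i\<in>UNIV. Y p (\<lambda>q. g q (X q) (E i q)) * E i p f + g p (X p) (E i p) * nabla Y (E i) p f)"
    by (rule trans[OF nabla_cong_right[OF Y X p eq] nabla_sum_right[OF Y p E x]])
  ultimately show ?thesis
    unfolding nabla_torsion_free[OF X Y p] nabla_torsion_free[OF E Y p]
    by (simp add: sum.distrib sum_subtractf right_diff_distrib algebra_simps)
qed

context
  fixes \<eta> :: "'m bilin_field" and V :: "'m set" and p :: 'm
  assumes \<eta>: "two_form_on A U \<eta>" and V: "V \<subseteq> U" and p: "p \<in> V"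
begin

lemma form_bilinear: "q \<in> U \<Longrightarrow> tangent_bilinear A q (\<eta> q)"
  and form_antisym: "q \<in> U \<Longrightarrow> u \<in> tangent_space A q \<Longrightarrow> v \<in> tangent_space A q \<Longrightarrow> \<eta> q u v = - \<eta> q v u"
  and form_smooth: "vector_field A V X \<Longrightarrow> vector_field A V Y \<Longrightarrow> smooth_fun_on A V (\<lambda>q. \<eta> q (X q) (Y q))"
  using \<eta> V unfolding two_form_on_def by blast+

private lemma base_in_U: "p \<in> U" using p V by blast

lemma form_uminus:
  assumes "u \<in> tangent_space A p" "v \<in> tangent_space A p"
  shows "\<eta> p (\<lambda>f. - u f) v = - \<eta> p u v"
  using tangent_linearD[OF tangent_bilinearD(2)[OF form_bilinear[OF base_in_U] assms(2)] assms(1,1), of "-1" 0]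
  by simp

lemma form_deriv_swap:
  assumes "vector_field A V W" "vector_field A V X" "vector_field A V Y"
  shows "W p (\<lambda>q. \<eta> q (X q) (Y q)) = - W p (\<lambda>q. \<eta> q (Y q) (X q))"
proof -
  note n = smooth_nearI[OF form_smooth p]
  have "W p (\<lambda>q. \<eta> q (X q) (Y q)) = W p (\<lambda>q. - \<eta> q (Y q) (X q))"
    by (rule tangent_cong[OF vector_fieldD(2)[OF assms(1) p] n[OF assms(2,3)]
          vector_fieldD(1)[OF assms(1)] p])
       (rule form_antisym[OF _ vector_fieldD(2)[OF assms(2)] vector_fieldD(2)[OF assms(3)]],
        use V in auto)
  also have "\<dots> = - W p (\<lambda>q. \<eta> q (Y q) (X q))"
    by (rule tangent_uminus[OF vector_fieldD(2)[OF assms(1) p] n[OF assms(3,2)]])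
  finally show ?thesis .
qed

lemma field_deriv_swap12:
  assumes X: "vector_field A V X" and Y: "vector_field A V Y" and Z: "vector_field A V Z"
  shows "field_deriv A \<eta> X Y Z p = - field_deriv A \<eta> Y X Z p"
  unfolding field_deriv_def
  using form_deriv_swap[OF Z X Y]
    form_uminus[OF lie_tangent[OF X Y p] vector_fieldD(2)[OF Z p]]
  by (simp add: lie_swap[of Y X])

lemma field_deriv_swap23:
  assumes X: "vector_field A V X" and Y: "vector_field A V Y" and Z: "vector_field A V Z"
  shows "field_deriv A \<eta> X Y Z p = - field_deriv A \<eta> X Z Y p"
  unfolding field_deriv_def
  using form_deriv_swap[OF X Y Z]
    form_uminus[OF lie_tangent[OF Y Z p] vector_fieldD(2)[OF X p]]
  by (simp add: lie_swap[of Z Y])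

lemma form_deriv_expand:
  assumes W: "vector_field A V W" and X: "vector_field A V X" and Y: "vector_field A V Y"
  shows "W p (\<lambda>q. \<eta> q (X q) (Y q)) = (\<Sum>i\<in>UNIV. g p (X p) (E i p) * W p (\<lambda>q. \<eta> q (E i q) (Y q))
    + \<eta> p (E i p) (Y p) * W p (\<lambda>q. g q (X q) (E i q)))"
proof -
  have oV: "open V" by (rule vector_fieldD(1)[OF X])
  have E: "vector_field A V (E i)" for i by (rule vector_field_subset[OF frame_field oV V])
  have Wp: "W p \<in> tangent_space A p" by (rule vector_fieldD(2)[OF W p])
  note n = smooth_nearI[OF form_smooth p] smooth_nearI[OF metric_smooth p]
  have "W p (\<lambda>q. \<eta> q (X q) (Y q)) = W p (\<lambda>q. \<Sum>i\<in>UNIV. g q (X q) (E i q) * \<eta> q (E i q) (Y q))"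
  proof (rule tangent_cong[OF Wp n(1)[OF X Y] oV p])
    fix q assume q: "q \<in> V"
    then have "q \<in> U" using V by blast
    show "\<eta> q (X q) (Y q) = (\<Sum>i\<in>UNIV. g q (X q) (E i q) * \<eta> q (E i q) (Y q))"
      by (rule onb_linear[OF frame_onb[OF \<open>q \<in> U\<close>] vector_fieldD(2)[OF X q]
            tangent_bilinearD(2)[OF form_bilinear[OF \<open>q \<in> U\<close>] vector_fieldD(2)[OF Y q]]])
  qed
  also have "\<dots> = (\<Sum>i\<in>UNIV. W p (\<lambda>q. g q (X q) (E i q) * \<eta> q (E i q) (Y q)))"
    by (intro tangent_sum[OF Wp] smooth_near_mult n X Y E)
  also have "\<dots> = (\<Sum>i\<in>UNIV. g p (X p) (E i p) * W p (\<lambda>q. \<eta> q (E i q) (Y q))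
      + \<eta> p (E i p) (Y p) * W p (\<lambda>q. g q (X q) (E i q)))"
    by (intro sum.cong refl tangent_mult[OF Wp] n X Y E)
  finally show ?thesis .
qed

lemma form_lie_expand:
  assumes X: "vector_field A V X" and Y: "vector_field A V Y" and z: "z \<in> tangent_space A p"
  shows "\<eta> p (lie A X Y p) z = (\<Sum>i\<in>UNIV. g p (X p) (E i p) * \<eta> p (lie A (E i) Y p) z)
    - (\<Sum>i\<in>UNIV. Y p (\<lambda>q. g q (X q) (E i q)) * \<eta> p (E i p) z)"
proof -
  have E: "vector_field A V (E i)" for i
    by (rule vector_field_subset[OF frame_field vector_fieldD(1)[OF X] V])
  note L = tangent_bilinearD(2)[OF form_bilinear[OF base_in_U] z]
  have lE: "lie A (E i) Y p \<in> tangent_space A p" for i by (rule lie_tangent[OF E Y p])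
  note T = tangent_space_sum[of UNIV "\<lambda>i. lie A (E i) Y p", OF lE]
    tangent_space_sum[of UNIV "\<lambda>i. E i p", OF frame_tangent[OF base_in_U]]
  show ?thesis
    unfolding lie_frame_expand[OF X Y p V] tangent_linear_diff[OF L T]
      tangent_linear_sum[OF L, of UNIV "\<lambda>i. lie A (E i) Y p", OF lE]
      tangent_linear_sum[OF L, of UNIV "\<lambda>i. E i p", OF frame_tangent[OF base_in_U]] ..
qed

text \<open>The derivatives of the coefficients of X cancel: those from the Leibniz rule in the
  Y-derivative against those from the bracket of X and Y, and likewise for Z. Hence the expression
  is linear over functions in X.\<close>

lemma field_deriv_expand1:
  assumes X: "vector_field A V X" and Y: "vector_field A V Y" and Z: "vector_field A V Z"
  shows "field_deriv A \<eta> X Y Z p = (\<Sum>i\<in>UNIV. g p (X p) (E i p) * field_deriv A \<eta> (E i) Y Z p)"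
proof -
  have "X p k = (\<Sum>i\<in>UNIV. g p (X p) (E i p) * E i p k)" for k
    using fun_cong[OF frame_expand_field[OF base_in_U vector_fieldD(2)[OF X p]]] .
  moreover have "\<eta> p (lie A Y Z p) (X p) = (\<Sum>i\<in>UNIV. g p (X p) (E i p) * \<eta> p (lie A Y Z p) (E i p))"
    by (rule onb_linear[OF frame_onb[OF base_in_U] vector_fieldD(2)[OF X p]
          tangent_bilinearD(1)[OF form_bilinear[OF base_in_U] lie_tangent[OF Y Z p]]])
  ultimately show ?thesis
    unfolding field_deriv_def form_deriv_expand[OF Y X Z] form_deriv_expand[OF Z X Y]
      form_lie_expand[OF X Y vector_fieldD(2)[OF Z p]] form_lie_expand[OF X Z vector_fieldD(2)[OF Y p]]
    by (simp add: sum.distrib sum_subtractf distrib_left right_diff_distrib mult.commute)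
qed

text \<open>The swap rules carry the second and the third argument into the first place, so
  linearity over functions needs to be established in one slot only.\<close>

lemma field_deriv_expand:
  assumes X: "vector_field A V X" and Y: "vector_field A V Y" and Z: "vector_field A V Z"
  shows "field_deriv A \<eta> X Y Z p = (\<Sum>i\<in>UNIV. \<Sum>j\<in>UNIV. \<Sum>k\<in>UNIV.
    g p (X p) (E i p) * g p (Y p) (E j p) * g p (Z p) (E k p) * field_deriv A \<eta> (E i) (E j) (E k) p)"
proof -
  have E: "vector_field A V (E i)" for i
    by (rule vector_field_subset[OF frame_field vector_fieldD(1)[OF X] V])
  have Y': "field_deriv A \<eta> (E i) Y Z p
      = (\<Sum>j\<in>UNIV. g p (Y p) (E j p) * field_deriv A \<eta> (E i) (E j) Z p)" for i
  proof -
    have "- field_deriv A \<eta> (E j) (E i) Z p = field_deriv A \<eta> (E i) (E j) Z p" for j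
      using field_deriv_swap12[OF E E Z, of i j] by linarith
    then show ?thesis
      using field_deriv_swap12[OF E Y Z, of i] field_deriv_expand1[OF Y E Z, of i]
      by (simp flip: sum_negf mult_minus_right)
  qed
  have Z': "field_deriv A \<eta> (E i) (E j) Z p
      = (\<Sum>k\<in>UNIV. g p (Z p) (E k p) * field_deriv A \<eta> (E i) (E j) (E k) p)" for i j
  proof -
    have "field_deriv A \<eta> (E k) (E i) (E j) p = field_deriv A \<eta> (E i) (E j) (E k) p" for k
      using field_deriv_swap12[OF E E E, of k i j] field_deriv_swap23[OF E E E, of i k j] by linarith
    moreover have "field_deriv A \<eta> (E i) (E j) Z p = field_deriv A \<eta> Z (E i) (E j) p"
      using field_deriv_swap12[OF Z E E, of i j] field_deriv_swap23[OF E E Z, of i j] by linarith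
    ultimately show ?thesis
      using field_deriv_expand1[OF Z E E, of i j] by simp
  qed
  show ?thesis
    unfolding field_deriv_expand1[OF X Y Z] Y' Z' by (simp add: sum_distrib_left mult.assoc)
qed

end

text \<open>The right-hand side involves the fields only through their values at \<open>p\<close>,
  so all extensions yield the same number; intersecting their domains with \<open>U\<close> makes
  the frame available.\<close>

lemma ext_deriv_eq:
  assumes \<eta>: "two_form_on A U \<eta>" and p: "p \<in> U" and u: "u \<in> tangent_space A p"
    and v: "v \<in> tangent_space A p" and z: "z \<in> tangent_space A p"
  shows "ext_deriv A \<eta> p u v z = (\<Sum>i\<in>UNIV. \<Sum>j\<in>UNIV. \<Sum>k\<in>UNIV.
    g p u (E i p) * g p v (E j p) * g p z (E k p) * field_deriv A \<eta> (E i) (E j) (E k) p)" (is "_ = ?r")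
proof -
  have *: "X p (\<lambda>q. \<eta> q (Y q) (Z q)) - Y p (\<lambda>q. \<eta> q (X q) (Z q)) + Z p (\<lambda>q. \<eta> q (X q) (Y q))
      - \<eta> p (lie A X Y p) z + \<eta> p (lie A X Z p) v - \<eta> p (lie A Y Z p) u = ?r"
    if X: "extends A p u X" and Y: "extends A p v Y" and Z: "extends A p z Z" for X Y Z
  proof -
    obtain V1 V2 V3 where V: "p \<in> V1" "vector_field A V1 X" "p \<in> V2" "vector_field A V2 Y"
      "p \<in> V3" "vector_field A V3 Z"
      using X Y Z by (auto simp: extends_def)
    let ?V = "U \<inter> V1 \<inter> V2 \<inter> V3"
    have o: "open ?V" using V open_U by (auto dest: vector_fieldD(1))
    have XYZ: "vector_field A ?V X" "vector_field A ?V Y" "vector_field A ?V Z"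
      using V o by (blast intro: vector_field_subset)+
    have "?V \<subseteq> U" "p \<in> ?V" using V p by auto
    from field_deriv_expand[OF \<eta> this XYZ] show ?thesis
      using X Y Z by (simp add: field_deriv_def extends_def)
  qed
  obtain X where X: "extends A p u X" using frame_extension[OF p u] by blast
  obtain Y where Y: "extends A p v Y" using frame_extension[OF p v] by blast
  obtain Z where Z: "extends A p z Z" using frame_extension[OF p z] by blast
  show ?thesis
    unfolding ext_deriv_def
  proof (rule the_equality)
    fix r
    assume "\<forall>X Y Z. extends A p u X \<longrightarrow> extends A p v Y \<longrightarrow> extends A p z Z \<longrightarrow>
      r = X p (\<lambda>q. \<eta> q (Y q) (Z q)) - Y p (\<lambda>q. \<eta> q (X q) (Z q)) + Z p (\<lambda>q. \<eta> q (X q) (Y q))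
        - \<eta> p (lie A X Y p) z + \<eta> p (lie A X Z p) v - \<eta> p (lie A Y Z p) u"
    from this[rule_format, OF X Y Z] show "r = ?r" by (simp only: *[OF X Y Z])
  qed (intro allI impI, rule *[symmetric])
qed

lemma ext_deriv_frame:
  assumes "two_form_on A U \<eta>" "p \<in> U"
  shows "ext_deriv A \<eta> p (E i p) (E j p) (E k p) = field_deriv A \<eta> (E i) (E j) (E k) p"
proof -
  have delta: "(\<Sum>l\<in>UNIV. (if m = l then 1 else 0) * c l) = c m" for m :: 'n and c :: "'n \<Rightarrow> real"
    by (simp add: if_distrib[of "\<lambda>x. x * _"] cong: if_cong)
  have "ext_deriv A \<eta> p (E i p) (E j p) (E k p)
      = (\<Sum>l\<in>UNIV. (if i = l then 1 else 0) * (\<Sum>m\<in>UNIV. (if j = m then 1 else 0) *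
          (\<Sum>n\<in>UNIV. (if k = n then 1 else 0) * field_deriv A \<eta> (E l) (E m) (E n) p)))"
    unfolding ext_deriv_eq[OF assms frame_tangent[OF assms(2)] frame_tangent[OF assms(2)]
        frame_tangent[OF assms(2)]] frame_metric[OF assms(2)]
    by (simp only: sum_distrib_left mult.assoc)
  then show ?thesis by (simp only: delta)
qed

end

section \<open>Hodge star, second fundamental forms\<close>

text \<open>The E_m-component of the form is a scalar bilinear form \<open>\<beta> m\<close>, so the
  squared norm is a sum of products of linear forms. This is an iterated trace, which may be
  evaluated in the frame itself.\<close>

lemma (in riemannian_manifold) second_fundamental_form_norm:
  fixes E :: "'n \<Rightarrow> 'm vfield" and w \<gamma> and p :: 'm
  defines "s \<equiv> \<lambda>i j m. (\<gamma> i j m p + \<gamma> j i m p) / 2"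
  assumes e: "orthonormal_basis A g p (\<lambda>i. E i p)"
    and w: "\<And>i. tangent_linear A p (w i p)" "\<And>i j. w i p (E j p) = (if i = j then 1 else 0)"
  shows "bilin_norm_sq A g p (second_fundamental_form E w \<gamma> P Q p)
    = (\<Sum>i\<in>P. \<Sum>j\<in>P. \<Sum>m\<in>Q. (s i j m)\<^sup>2)"
proof -
  define \<beta> where "\<beta> = (\<lambda>m u v. \<Sum>i\<in>P. \<Sum>j\<in>P. s i j m * w i p u * w j p v)"
  have II: "second_fundamental_form E w \<gamma> P Q p u v = (\<lambda>k. \<Sum>m\<in>Q. \<beta> m u v * E m p k)" for u v
    unfolding second_fundamental_form_def \<beta>_def s_def sum_distrib_right
    by (intro ext trans[OF sum.cong[OF refl sum.swap] sum.swap])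
  have norm: "g p (second_fundamental_form E w \<gamma> P Q p u v) (second_fundamental_form E w \<gamma> P Q p u' v')
      = (\<Sum>m\<in>Q. \<beta> m u v * \<beta> m u' v')" for u v u' v'
    unfolding II by (rule onb_metric_sums[OF e])
  have lin: "tangent_linear A p (\<lambda>v. \<beta> m u v)" "tangent_linear A p (\<lambda>v. \<beta> m v u)" for m u
    unfolding \<beta>_def mult.assoc mult.commute[of "w _ p _" "w _ p u"]
    by (intro tangent_linear_sum_fun tangent_linear_cmult w)+
  have "bilin_norm_sq A g p (second_fundamental_form E w \<gamma> P Q p)
      = (\<Sum>i\<in>UNIV. \<Sum>j\<in>UNIV. \<Sum>m\<in>Q. \<beta> m (E i p) (E j p) * \<beta> m (E i p) (E j p))"
    by (subst bilin_norm_sq_eq[OF e])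
       (unfold norm, intro tangent_bilinear_sum tangent_bilinear_mult lin,
        intro tangent_bilinear_sum tangent_bilinear_mult lin, rule refl)
  also have "\<dots> = (\<Sum>i\<in>UNIV. \<Sum>j\<in>UNIV. if i \<in> P then if j \<in> P then \<Sum>m\<in>Q. (s i j m)\<^sup>2 else 0 else 0)"
  proof (intro sum.cong refl)
    fix i j
    have "\<beta> m (E i p) (E j p) = (if i \<in> P then if j \<in> P then s i j m else 0 else 0)" for m
    proof -
      have "\<beta> m (E i p) (E j p)
          = (\<Sum>k\<in>P. \<Sum>l\<in>P. if k = i then if l = j then s k l m else 0 else 0)"
        unfolding \<beta>_def w(2) by (intro sum.cong refl) auto
      also have "\<dots> = (\<Sum>k\<in>P. if k = i then \<Sum>l\<in>P. if l = j then s k l m else 0 else 0)"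
        by (intro sum.cong refl) simp
      finally show ?thesis by simp
    qed
    then show "(\<Sum>m\<in>Q. \<beta> m (E i p) (E j p) * \<beta> m (E i p) (E j p))
        = (if i \<in> P then if j \<in> P then \<Sum>m\<in>Q. (s i j m)\<^sup>2 else 0 else 0)"
      by (simp add: power2_eq_square)
  qed
  also have "\<dots> = (\<Sum>i\<in>UNIV. if i \<in> P then \<Sum>j\<in>UNIV. if j \<in> P then \<Sum>m\<in>Q. (s i j m)\<^sup>2 else 0 else 0)"
    by (intro sum.cong refl) simp
  also have "\<dots> = (\<Sum>i\<in>P. \<Sum>j\<in>P. \<Sum>m\<in>Q. (s i j m)\<^sup>2)"
    by (simp add: sum.If_cases)
  finally show ?thesis .
qed

text \<open>The right-hand side of \<open>det_4\<close> for the matrix with columns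
  \<open>x\<close>, \<open>y\<close>, \<open>z\<close>, \<open>u\<close>, kept explicit so that
  linearity in each column is a polynomial identity.\<close>

definition det4 :: "(4 \<Rightarrow> real) \<Rightarrow> (4 \<Rightarrow> real) \<Rightarrow> (4 \<Rightarrow> real) \<Rightarrow> (4 \<Rightarrow> real) \<Rightarrow> real" where
  "det4 x y z u =
    (x 1 * y 2 - x 2 * y 1) * (z 3 * u 4 - z 4 * u 3)
  - (x 1 * y 3 - x 3 * y 1) * (z 2 * u 4 - z 4 * u 2)
  + (x 1 * y 4 - x 4 * y 1) * (z 2 * u 3 - z 3 * u 2)
  + (x 2 * y 3 - x 3 * y 2) * (z 1 * u 4 - z 4 * u 1)
  - (x 2 * y 4 - x 4 * y 2) * (z 1 * u 3 - z 3 * u 1)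
  + (x 3 * y 4 - x 4 * y 3) * (z 1 * u 2 - z 2 * u 1)"

text \<open>Only the six orderings of the three indices other than \<open>l\<close> contribute, all
  equally because both factors alternate; this uses up the 6. The sign is that of the permutation
  which lists these indices increasingly and \<open>l\<close> last.\<close>

lemma alternating_star:
  fixes \<Theta> :: "4 \<Rightarrow> 4 \<Rightarrow> 4 \<Rightarrow> real"
  assumes swap12: "\<And>i j k. \<Theta> i j k = - \<Theta> j i k" and swap23: "\<And>i j k. \<Theta> i j k = - \<Theta> i k j"
  defines "\<delta> \<equiv> \<lambda>i j. if i = j then 1 else 0"
  shows "(\<Sum>i\<in>UNIV. \<Sum>j\<in>UNIV. \<Sum>k\<in>UNIV. \<Theta> i j k * det4 (\<delta> i) (\<delta> j) (\<delta> k) (\<delta> l)) / 6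
    = (if l = 4 then \<Theta> 1 2 3 else if l = 3 then - \<Theta> 1 2 4 else if l = 2 then \<Theta> 1 3 4
       else - \<Theta> 2 3 4)"
proof -
  have c: "\<Theta> 2 1 k = - \<Theta> 1 2 k" "\<Theta> 3 1 k = - \<Theta> 1 3 k" "\<Theta> 4 1 k = - \<Theta> 1 4 k"
    "\<Theta> 3 2 k = - \<Theta> 2 3 k" "\<Theta> 4 2 k = - \<Theta> 2 4 k" "\<Theta> 4 3 k = - \<Theta> 3 4 k"
    "\<Theta> k 2 1 = - \<Theta> k 1 2" "\<Theta> k 3 1 = - \<Theta> k 1 3" "\<Theta> k 4 1 = - \<Theta> k 1 4"
    "\<Theta> k 3 2 = - \<Theta> k 2 3" "\<Theta> k 4 2 = - \<Theta> k 2 4" "\<Theta> k 4 3 = - \<Theta> k 3 4" for k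
    by (rule swap12 swap23)+
  show ?thesis
    using exhaust_4[of l] by (elim disjE) (simp_all add: sum_4 det4_def \<delta>_def c)
qed

section \<open>Volume form, Hodge star and codifferential in the frame\<close>

locale levi_civita_frame4 = levi_civita_frame A g nabla U E \<gamma>
  for A :: "('m::{t2_space, second_countable_topology}, 4) atlas" and g nabla U E \<gamma>
begin

lemma volume_frame:
  assumes q: "q \<in> U" and x: "x \<in> tangent_space A q" and y: "y \<in> tangent_space A q"
    and z: "z \<in> tangent_space A q" and u: "u \<in> tangent_space A q"
  shows "volume_form A g q (quad x y z u) = det4 (\<lambda>i. g q x (E i q)) (\<lambda>i. g q y (E i q))
    (\<lambda>i. g q z (E i q)) (\<lambda>i. g q u (E i q))"
proof -
  have "quad x y z u j \<in> tangent_space A q" for j using x y z u by (simp add: quad_def)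
  then have "volume_form A g q (quad x y z u) = det (\<chi> i j. g q (quad x y z u j) (E i q))"
    by (simp add: volume_form_eq[OF frame_onb[OF q] frame_positive[OF q]]
        metric_sym[OF frame_tangent[OF q]])
  then show ?thesis by (simp add: det_4 det4_def quad_def)
qed

lemma volume_linear:
  assumes q: "q \<in> U" and "x \<in> tangent_space A q" and "y \<in> tangent_space A q" and "z \<in> tangent_space A q"
  shows "tangent_linear A q (\<lambda>u. volume_form A g q (quad u x y z))"
    and "tangent_linear A q (\<lambda>u. volume_form A g q (quad x u y z))"
    and "tangent_linear A q (\<lambda>u. volume_form A g q (quad x y u z))"
proof -
  note m = tangent_linearD[OF tangent_linear_metric[OF frame_tangent[OF q]]]
  let ?c = "\<lambda>u i. g q u (E i q)"
  have d: "tangent_linear A q (\<lambda>u. det4 (?c u) (?c x) (?c y) (?c z))"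
    "tangent_linear A q (\<lambda>u. det4 (?c x) (?c u) (?c y) (?c z))"
    "tangent_linear A q (\<lambda>u. det4 (?c x) (?c y) (?c u) (?c z))"
    unfolding tangent_linear_def det4_def by (simp_all add: m algebra_simps)
  show "tangent_linear A q (\<lambda>u. volume_form A g q (quad u x y z))"
    by (rule tangent_linear_cong[OF d(1)]) (simp add: volume_frame assms)
  show "tangent_linear A q (\<lambda>u. volume_form A g q (quad x u y z))"
    by (rule tangent_linear_cong[OF d(2)]) (simp add: volume_frame assms)
  show "tangent_linear A q (\<lambda>u. volume_form A g q (quad x y u z))"
    by (rule tangent_linear_cong[OF d(3)]) (simp add: volume_frame assms)
qed

text \<open>The 2-form \<open>\<alpha>\<close> w^1 wedge w^2 + \<open>\<beta>\<close> w^3 wedge w^4,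
  with w^i written as the metric dual of E_i. Both coefficients are parameters because the form and
  its Hodge star are the two instances with coefficients exchanged.\<close>

definition coframe_form :: "('m \<Rightarrow> real) \<Rightarrow> ('m \<Rightarrow> real) \<Rightarrow> 'm bilin_field" where
  "coframe_form \<alpha> \<beta> q u v =
     \<alpha> q * (g q u (E 1 q) * g q v (E 2 q) - g q v (E 1 q) * g q u (E 2 q))
   + \<beta> q * (g q u (E 3 q) * g q v (E 4 q) - g q v (E 3 q) * g q u (E 4 q))"

text \<open>Plain numbers as coefficients allow the same expression for the values of a form and for
  their derivatives along the frame.\<close>

definition frame_value :: "real \<Rightarrow> real \<Rightarrow> 4 \<Rightarrow> 4 \<Rightarrow> real" where
  "frame_value \<alpha> \<beta> j k = \<alpha> * (of_bool (j = 1 \<and> k = 2) - of_bool (j = 2 \<and> k = 1))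
     + \<beta> * (of_bool (j = 3 \<and> k = 4) - of_bool (j = 4 \<and> k = 3))"

lemma coframe_form_frame:
  "q \<in> U \<Longrightarrow> coframe_form \<alpha> \<beta> q (E j q) (E k q) = frame_value (\<alpha> q) (\<beta> q) j k"
  by (auto simp: coframe_form_def frame_metric frame_value_def)

lemma coframe_form_bilinear:
  assumes "q \<in> U"
  shows "tangent_bilinear A q (coframe_form \<alpha> \<beta> q)"
  unfolding tangent_bilinear_def tangent_linear_def coframe_form_def
  by (simp add: tangent_linearD[OF tangent_linear_metric[OF frame_tangent[OF assms]]] algebra_simps)

context
  fixes \<eta> \<alpha> \<beta>
  assumes \<eta>: "\<forall>q\<in>U. \<forall>u\<in>tangent_space A q. \<forall>v\<in>tangent_space A q.
    \<eta> q u v = coframe_form \<alpha> \<beta> q u v"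
begin

lemma coframe_bilinear: "q \<in> U \<Longrightarrow> tangent_bilinear A q (\<eta> q)"
  by (rule tangent_bilinear_cong[OF coframe_form_bilinear]) (simp_all add: \<eta>[rule_format])

text \<open>The star exchanges w^1 wedge w^2 with w^3 wedge w^4 for an oriented orthonormal frame.
  The volume form is already independent of bases, so only the two contracted slots have to be moved
  from an arbitrary orthonormal basis to the frame.\<close>

lemma hodge_star2_coframe:
  assumes p: "p \<in> U" and u: "u \<in> tangent_space A p" and v: "v \<in> tangent_space A p"
  shows "hodge_star2 A g \<eta> p u v = coframe_form \<beta> \<alpha> p u v"
proof -
  have E: "(\<Sum>i\<in>UNIV. \<Sum>j\<in>UNIV. \<eta> p (E i p) (E j p) * volume_form A g p (quad (E i p) (E j p) u v)) / 2
      = coframe_form \<beta> \<alpha> p u v"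
    by (simp add: \<eta>[rule_format, OF p frame_tangent[OF p] frame_tangent[OF p]] coframe_form_frame[OF p]
        volume_frame[OF p frame_tangent[OF p] frame_tangent[OF p] u v] sum_4 frame_value_def
        frame_metric[OF p] det4_def coframe_form_def)
       (simp add: field_simps)
  have inv: "(\<Sum>i\<in>UNIV. \<Sum>j\<in>UNIV. \<eta> p (b i) (b j) * volume_form A g p (quad (b i) (b j) u v)) / 2
      = coframe_form \<beta> \<alpha> p u v" if b: "orthonormal_basis A g p b" for b
    unfolding E[symmetric]
  proof (rule arg_cong[where f = "\<lambda>r. r / 2"], rule onb_trace2[OF b frame_onb[OF p],
        where Q = "\<lambda>x x' y y'. \<eta> p x y * volume_form A g p (quad x' y' u v)"])
    fix y assume y: "y \<in> tangent_space A p"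
    show "tangent_bilinear A p (\<lambda>x x'. \<eta> p x y * volume_form A g p (quad x' y u v))"
      by (rule tangent_bilinear_mult[OF tangent_bilinearD(2)[OF coframe_bilinear[OF p] y]
            volume_linear(1)[OF p y u v]])
    show "tangent_bilinear A p (\<lambda>x x'. \<eta> p y x * volume_form A g p (quad y x' u v))"
      by (rule tangent_bilinear_mult[OF tangent_bilinearD(1)[OF coframe_bilinear[OF p] y]
            volume_linear(2)[OF p y u v]])
  qed
  show ?thesis
    unfolding hodge_star2_def
  proof (rule the_equality)
    fix r
    assume "\<forall>b. orthonormal_basis A g p b \<longrightarrow>
      r = (\<Sum>i\<in>UNIV. \<Sum>j\<in>UNIV. \<eta> p (b i) (b j) * volume_form A g p (quad (b i) (b j) u v)) / 2"
    from this[rule_format, OF frame_onb[OF p]] show "r = coframe_form \<beta> \<alpha> p u v"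
      by (simp only: inv[OF frame_onb[OF p]])
  qed (intro allI impI, rule inv[symmetric])
qed

lemma two_form_on_coframe:
  assumes \<alpha>: "smooth_fun_on A U \<alpha>" and \<beta>: "smooth_fun_on A U \<beta>"
  shows "two_form_on A U \<eta>"
  unfolding two_form_on_def
proof (intro conjI ballI allI impI)
  show "tangent_bilinear A q (\<eta> q)" if "q \<in> U" for q using that by (rule coframe_bilinear)
  show "\<eta> q u v = - \<eta> q v u" if "q \<in> U" "u \<in> tangent_space A q" "v \<in> tangent_space A q" for q u v
    using that by (simp add: \<eta>[rule_format] coframe_form_def algebra_simps)
  show "smooth_fun_on A V (\<lambda>q. \<eta> q (X q) (Y q))"
    if V: "V \<subseteq> U" and X: "vector_field A V X" and Y: "vector_field A V Y" for V X Y
  proof (rule smooth_fun_on_cong)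
    have oV: "open V" by (rule vector_fieldD(1)[OF X])
    have E: "vector_field A V (E i)" for i by (rule vector_field_subset[OF frame_field oV V])
    show "smooth_fun_on A V (\<lambda>q. coframe_form \<alpha> \<beta> q (X q) (Y q))"
      unfolding coframe_form_def
      by (intro smooth_fun_on_add smooth_fun_on_mult smooth_fun_on_diff metric_smooth X Y E
          smooth_fun_on_subset[OF \<alpha> oV V] smooth_fun_on_subset[OF \<beta> oV V])
    show "coframe_form \<alpha> \<beta> q (X q) (Y q) = \<eta> q (X q) (Y q)" if "q \<in> V" for q
      using that V vector_fieldD(2)[OF X that] vector_fieldD(2)[OF Y that] \<eta>[rule_format, of q "X q" "Y q"] by auto
  qed
qed

text \<open>The values on frame vectors are combinations of \<open>\<alpha>\<close> and
  \<open>\<beta>\<close> with constant coefficients, so differentiating them only replaces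
  \<open>\<alpha>\<close> and \<open>\<beta>\<close> by their derivatives. The brackets contribute
  the antisymmetrized connection coefficients.\<close>

lemma field_deriv_coframe:
  assumes \<alpha>: "smooth_fun_on A U \<alpha>" and \<beta>: "smooth_fun_on A U \<beta>" and p: "p \<in> U"
  shows "field_deriv A \<eta> (E i) (E j) (E k) p =
    frame_value (E i p \<alpha>) (E i p \<beta>) j k - frame_value (E j p \<alpha>) (E j p \<beta>) i k
    + frame_value (E k p \<alpha>) (E k p \<beta>) i j
    - (\<Sum>l\<in>UNIV. (\<gamma> i j l p - \<gamma> j i l p) * frame_value (\<alpha> p) (\<beta> p) l k)
    + (\<Sum>l\<in>UNIV. (\<gamma> i k l p - \<gamma> k i l p) * frame_value (\<alpha> p) (\<beta> p) l j)
    - (\<Sum>l\<in>UNIV. (\<gamma> j k l p - \<gamma> k j l p) * frame_value (\<alpha> p) (\<beta> p) l i)"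
proof -
  note n = smooth_nearI[OF \<alpha> p] smooth_nearI[OF \<beta> p]
  have E: "E i p (\<lambda>q. \<eta> q (E j q) (E k q)) = frame_value (E i p \<alpha>) (E i p \<beta>) j k" for i j k
  proof -
    note Ei = frame_tangent[OF p, of i]
    obtain s t where st: "frame_value x y j k = s * x + t * y" for x y
      by (rule that[of "of_bool (j = 1 \<and> k = 2) - of_bool (j = 2 \<and> k = 1)"
            "of_bool (j = 3 \<and> k = 4) - of_bool (j = 4 \<and> k = 3)"]) (simp add: frame_value_def)
    have "E i p (\<lambda>q. \<eta> q (E j q) (E k q)) = E i p (\<lambda>q. s * \<alpha> q + t * \<beta> q)"
      by (rule tangent_cong[OF Ei _ open_U p, symmetric])
         (auto intro!: smooth_near_add smooth_near_cmult n
           simp: \<eta>[rule_format] frame_tangent coframe_form_frame st)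
    also have "\<dots> = frame_value (E i p \<alpha>) (E i p \<beta>) j k"
      by (simp add: tangent_add[OF Ei] smooth_near_cmult n tangent_cmult[OF Ei] st)
    finally show ?thesis .
  qed
  have lie: "\<eta> p (lie A (E i) (E j) p) (E k p)
      = (\<Sum>l\<in>UNIV. (\<gamma> i j l p - \<gamma> j i l p) * frame_value (\<alpha> p) (\<beta> p) l k)" for i j k
  proof -
    have "\<eta> p (lie A (E i) (E j) p) (E k p) = (\<Sum>l\<in>UNIV. (\<gamma> i j l p - \<gamma> j i l p) * \<eta> p (E l p) (E k p))"
      unfolding lie_frame[OF p]
      by (rule tangent_linear_sum[OF tangent_bilinearD(2)[OF coframe_bilinear[OF p]]])
         (rule frame_tangent[OF p])+
    then show ?thesis
      by (simp add: \<eta>[rule_format, OF p frame_tangent[OF p] frame_tangent[OF p]] coframe_form_frame[OF p])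
  qed
  show ?thesis unfolding field_deriv_def E lie ..
qed

end

text \<open>The exterior derivative inherits linearity in each slot from its frame sum; this makes
  the threefold contraction independent of the basis, and in the frame it is the sum of
  \<open>alternating_star\<close>.\<close>

lemma codifferential_frame:
  assumes \<eta>: "two_form_on A U (hodge_star2 A g h)" and p: "p \<in> U"
  defines "\<Theta> \<equiv> \<lambda>i j k. field_deriv A (hodge_star2 A g h) (E i) (E j) (E k) p"
  shows "codifferential A g h p (E l p)
    = - (if l = 4 then \<Theta> 1 2 3 else if l = 3 then - \<Theta> 1 2 4 else if l = 2 then \<Theta> 1 3 4 else - \<Theta> 2 3 4)"
    (is "_ = - ?r")
proof -
  let ?\<theta> = "ext_deriv A (hodge_star2 A g h) p"
  let ?Q = "\<lambda>x x' y y' z z'. ?\<theta> x y z * volume_form A g p (quad x' y' z' (E l p))"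
  note T = frame_tangent[OF p]
  have E: "(\<Sum>i\<in>UNIV. \<Sum>j\<in>UNIV. \<Sum>k\<in>UNIV. ?\<theta> (E i p) (E j p) (E k p)
      * volume_form A g p (quad (E i p) (E j p) (E k p) (E l p))) / 6 = ?r"
  proof -
    have "\<Theta> i j k = - \<Theta> j i k" "\<Theta> i j k = - \<Theta> i k j" for i j k
      unfolding \<Theta>_def
      by (rule field_deriv_swap12[OF \<eta> subset_refl p frame_field frame_field frame_field],
          rule field_deriv_swap23[OF \<eta> subset_refl p frame_field frame_field frame_field])
    from alternating_star[OF this, where l = l] show ?thesis
      by (simp only: ext_deriv_frame[OF \<eta> p] \<Theta>_def volume_frame[OF p T T T T] frame_metric[OF p])
  qed
  have lin: "tangent_linear A p (\<lambda>x. ?\<theta> x y z)" "tangent_linear A p (\<lambda>x. ?\<theta> y x z)"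
    "tangent_linear A p (?\<theta> y z)" if "y \<in> tangent_space A p" "z \<in> tangent_space A p" for y z
  proof -
    note m = tangent_linearD[OF tangent_linear_metric[OF T]]
    let ?s = "\<lambda>x y z. \<Sum>i\<in>UNIV. \<Sum>j\<in>UNIV. \<Sum>k\<in>UNIV. g p x (E i p) * g p y (E j p) * g p z (E k p) * \<Theta> i j k"
    have d: "tangent_linear A p (\<lambda>x. ?s x y z)" "tangent_linear A p (\<lambda>x. ?s y x z)"
      "tangent_linear A p (?s y z)"
      by (intro tangent_linear_sum_fun; simp add: tangent_linear_def m algebra_simps)+
    show "tangent_linear A p (\<lambda>x. ?\<theta> x y z)"
      by (rule tangent_linear_cong[OF d(1)]) (simp add: ext_deriv_eq[OF \<eta> p] that \<Theta>_def)
    show "tangent_linear A p (\<lambda>x. ?\<theta> y x z)"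
      by (rule tangent_linear_cong[OF d(2)]) (simp add: ext_deriv_eq[OF \<eta> p] that \<Theta>_def)
    show "tangent_linear A p (?\<theta> y z)"
      by (rule tangent_linear_cong[OF d(3)]) (simp add: ext_deriv_eq[OF \<eta> p] that \<Theta>_def)
  qed
  have "(\<Sum>i\<in>UNIV. \<Sum>j\<in>UNIV. \<Sum>k\<in>UNIV. ?\<theta> (b i) (b j) (b k)
      * volume_form A g p (quad (b i) (b j) (b k) (E l p))) / 6 = ?r"
    if b: "orthonormal_basis A g p b" for b
    unfolding E[symmetric]
  proof (rule arg_cong[where f = "\<lambda>r. r / 6"], rule onb_trace3[OF b frame_onb[OF p], where Q = ?Q])
    fix y z assume yz: "y \<in> tangent_space A p" "z \<in> tangent_space A p"
    show "tangent_bilinear A p (\<lambda>x x'. ?Q x x' y y z z)"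
      by (rule tangent_bilinear_mult[OF lin(1)[OF yz] volume_linear(1)[OF p yz T]])
    show "tangent_bilinear A p (\<lambda>x x'. ?Q y y x x' z z)"
      by (rule tangent_bilinear_mult[OF lin(2)[OF yz] volume_linear(2)[OF p yz T]])
    show "tangent_bilinear A p (?Q y y z z)"
      by (rule tangent_bilinear_mult[OF lin(3)[OF yz] volume_linear(3)[OF p yz T]])
  qed
  then have "hodge_star3 A g (ext_deriv A (hodge_star2 A g h)) p (E l p) = ?r"
    unfolding hodge_star3_def using frame_onb[OF p] by (intro the_equality) (auto simp: eq_commute)
  then show ?thesis by (simp add: codifferential_def)
qed

end

section \<open>Harmonic 2-forms\<close>

text \<open>\<open>f\<close> is half the logarithm of the positive function a^2 - b^2. The
  derivative is stated after multiplication by a^2 - b^2, the form in which the equations for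
  \<open>a\<close> and \<open>b\<close> are later substituted.\<close>

lemma (in oriented_manifold) ln_sqrt_smooth:
  assumes a: "smooth_fun_on A U a" and b: "smooth_fun_on A U b"
    and ab: "\<forall>q\<in>U. \<bar>b q\<bar> < a q"
    and f: "\<forall>q\<in>U. f q = ln (sqrt ((a q)\<^sup>2 - (b q)\<^sup>2))"
  shows ln_sqrt_smooth_fun: "smooth_fun_on A U f"
    and ln_sqrt_deriv: "q \<in> U \<Longrightarrow> v \<in> tangent_space A q \<Longrightarrow>
      v f * ((a q)\<^sup>2 - (b q)\<^sup>2) = a q * v a - b q * v b"
proof -
  let ?F = "\<lambda>q. a q * a q - b q * b q"
  have F: "smooth_fun_on A U ?F"
    by (intro smooth_fun_on_diff smooth_fun_on_mult a b)
  have pos: "0 < ?F q" if "q \<in> U" for q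
    using power_strict_mono[OF ab[rule_format, OF that], of 2] by (simp add: power2_eq_square)
  have f': "1 / 2 * ln (?F q) = f q" if "q \<in> U" for q
    using pos[OF that] f[rule_format, OF that] by (simp add: ln_sqrt power2_eq_square)
  have ln: "smooth_fun_on A U (\<lambda>q. ln (?F q))"
    by (rule smooth_fun_on_compose_real[OF F smooth_on_ln]) (use pos in auto)
  show "smooth_fun_on A U f"
    by (rule smooth_fun_on_cong[OF smooth_fun_on_cmult[OF ln] f'])
  assume q: "q \<in> U" and v: "v \<in> tangent_space A q"
  note n = smooth_nearI[OF a q] smooth_nearI[OF b q] smooth_nearI[OF ln q]
  define N where "N = a q * v a - b q * v b"
  have "v f = v (\<lambda>q. 1 / 2 * ln (?F q))"
    by (rule tangent_cong[OF v smooth_near_cmult[OF n(3)] smooth_fun_on_open[OF a] q f', symmetric])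
  also have "\<dots> = 1 / 2 * (v ?F / ?F q)"
    by (subst tangent_cmult[OF v n(3)]) (simp only: tangent_ln[OF v F q pos])
  also have "v ?F = 2 * N"
    unfolding N_def by (simp add: tangent_diff[OF v] smooth_near_mult n tangent_mult[OF v])
  finally have "v f = N / ?F q" by simp
  then show "v f * ((a q)\<^sup>2 - (b q)\<^sup>2) = a q * v a - b q * v b"
    using pos[OF q] by (simp add: power2_eq_square N_def)
qed

section \<open>The gradient as sum of the mean curvatures\<close>

context levi_civita_frame4
begin

lemma harmonic_form_gradient:
  assumes h: "smooth_bilin_field A h" and closed: "closed_form A h" and coclosed: "coclosed_form A g h"
    and h_eq: "\<forall>q\<in>U. \<forall>u\<in>tangent_space A q. \<forall>v\<in>tangent_space A q.
      h q u v = coframe_form a b q u v"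
    and ab: "\<forall>q\<in>U. \<bar>b q\<bar> < a q"
    and f: "\<forall>q\<in>U. f q = ln (sqrt ((a q)\<^sup>2 - (b q)\<^sup>2))"
  shows "smooth_fun_on A U f"
    and "q \<in> U \<Longrightarrow> E 1 q f = \<gamma> 3 3 1 q + \<gamma> 4 4 1 q"
    and "q \<in> U \<Longrightarrow> E 2 q f = \<gamma> 3 3 2 q + \<gamma> 4 4 2 q"
    and "q \<in> U \<Longrightarrow> E 3 q f = \<gamma> 1 1 3 q + \<gamma> 2 2 3 q"
    and "q \<in> U \<Longrightarrow> E 4 q f = \<gamma> 1 1 4 q + \<gamma> 2 2 4 q"
proof -
  have h_frame: "h q (E i q) (E j q) = frame_value (a q) (b q) i j" if "q \<in> U" for q i j
    by (simp add: h_eq[rule_format] that frame_tangent coframe_form_frame)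
  have h_smooth: "smooth_fun_on A U (\<lambda>q. h q (E i q) (E j q))" for i j
    using h frame_field by (auto simp: smooth_bilin_field_def)
  \<comment> \<open>Smoothness of \<open>a\<close> and \<open>b\<close> comes from \<open>h\<close>:
    they are its values on (E_1, E_2) and on (E_3, E_4).\<close>
  have a: "smooth_fun_on A U a"
    by (rule smooth_fun_on_cong[OF h_smooth[of 1 2]]) (simp add: h_frame frame_value_def)
  have b: "smooth_fun_on A U b"
    by (rule smooth_fun_on_cong[OF h_smooth[of 3 4]]) (simp add: h_frame frame_value_def)
  show "smooth_fun_on A U f" by (rule ln_sqrt_smooth_fun[OF a b ab f])
  assume q: "q \<in> U"
  let ?s = "hodge_star2 A g h"
  have s_eq: "\<forall>q\<in>U. \<forall>u\<in>tangent_space A q. \<forall>v\<in>tangent_space A q. ?s q u v = coframe_form b a q u v"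
    by (intro ballI hodge_star2_coframe[OF h_eq])
  have dh: "field_deriv A h (E i) (E j) (E k) q = 0" for i j k
    using closed ext_deriv_frame[OF two_form_on_coframe[OF h_eq a b] q, of i j k] frame_tangent[OF q]
    by (simp add: closed_form_def)
  have "codifferential A g h q (E l q) = 0" for l
    using coclosed frame_tangent[OF q] by (simp add: coclosed_form_def)
  note ds = this[unfolded codifferential_frame[OF two_form_on_coframe[OF s_eq b a] q]]
  have ds: "field_deriv A ?s (E 1) (E 2) (E 3) q = 0" "field_deriv A ?s (E 1) (E 2) (E 4) q = 0"
    "field_deriv A ?s (E 1) (E 3) (E 4) q = 0" "field_deriv A ?s (E 2) (E 3) (E 4) q = 0"
    using ds[of 4] ds[of 3] ds[of 2] ds[of 1] by simp_all
  have D: "(a q)\<^sup>2 - (b q)\<^sup>2 \<noteq> 0"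
    using power_strict_mono[OF ab[rule_format, OF q], of 2] by simp
  note fd = field_deriv_coframe[OF h_eq a b q] field_deriv_coframe[OF s_eq b a q]
  note grad = ln_sqrt_deriv[OF a b ab f q frame_tangent[OF q]]
  note anti = coefficient_antisym[OF q]
  have cancel: "x = y" if "x * ((a q)\<^sup>2 - (b q)\<^sup>2) = y * ((a q)\<^sup>2 - (b q)\<^sup>2)" for x y
    using that D by simp
  have 1: "\<gamma> i j j q = 0" for i j using anti[of i j j] by simp
  show "E 1 q f = \<gamma> 3 3 1 q + \<gamma> 4 4 1 q"
  proof (rule cancel)
    \<comment> \<open>The component on E_1, E_3, E_4 differentiates along E_1 the coefficient of w^3
      wedge w^4, which is \<open>b\<close> for the form and \<open>a\<close> for its star. For E_3
      and E_4 the coefficient of w^1 wedge w^2 is differentiated, and the roles are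
      exchanged.\<close>
    have e: "E 1 q b = b q * (\<gamma> 3 3 1 q + \<gamma> 4 4 1 q) - a q * (\<gamma> 3 4 2 q - \<gamma> 4 3 2 q)"
      "E 1 q a = a q * (\<gamma> 3 3 1 q + \<gamma> 4 4 1 q) - b q * (\<gamma> 3 4 2 q - \<gamma> 4 3 2 q)"
      using dh[of 1 3 4] ds(3) anti[of 3 1 3] anti[of 4 1 4]
      unfolding fd by (simp_all add: sum_4 frame_value_def 1 algebra_simps)
    show "E 1 q f * ((a q)\<^sup>2 - (b q)\<^sup>2) = (\<gamma> 3 3 1 q + \<gamma> 4 4 1 q) * ((a q)\<^sup>2 - (b q)\<^sup>2)"
      unfolding grad e by (simp add: algebra_simps power2_eq_square)
  qed
  show "E 2 q f = \<gamma> 3 3 2 q + \<gamma> 4 4 2 q"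
  proof (rule cancel)
    have e: "E 2 q b = b q * (\<gamma> 3 3 2 q + \<gamma> 4 4 2 q) + a q * (\<gamma> 3 4 1 q - \<gamma> 4 3 1 q)"
      "E 2 q a = a q * (\<gamma> 3 3 2 q + \<gamma> 4 4 2 q) + b q * (\<gamma> 3 4 1 q - \<gamma> 4 3 1 q)"
      using dh[of 2 3 4] ds(4) anti[of 3 2 3] anti[of 4 2 4]
      unfolding fd by (simp_all add: sum_4 frame_value_def 1 algebra_simps)
    show "E 2 q f * ((a q)\<^sup>2 - (b q)\<^sup>2) = (\<gamma> 3 3 2 q + \<gamma> 4 4 2 q) * ((a q)\<^sup>2 - (b q)\<^sup>2)"
      unfolding grad e by (simp add: algebra_simps power2_eq_square)
  qed
  show "E 3 q f = \<gamma> 1 1 3 q + \<gamma> 2 2 3 q"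
  proof (rule cancel)
    have e: "E 3 q a = a q * (\<gamma> 1 1 3 q + \<gamma> 2 2 3 q) - b q * (\<gamma> 1 2 4 q - \<gamma> 2 1 4 q)"
      "E 3 q b = b q * (\<gamma> 1 1 3 q + \<gamma> 2 2 3 q) - a q * (\<gamma> 1 2 4 q - \<gamma> 2 1 4 q)"
      using dh[of 1 2 3] ds(1) anti[of 1 1 3] anti[of 2 2 3]
      unfolding fd by (simp_all add: sum_4 frame_value_def 1 algebra_simps)
    show "E 3 q f * ((a q)\<^sup>2 - (b q)\<^sup>2) = (\<gamma> 1 1 3 q + \<gamma> 2 2 3 q) * ((a q)\<^sup>2 - (b q)\<^sup>2)"
      unfolding grad e by (simp add: algebra_simps power2_eq_square)
  qed
  show "E 4 q f = \<gamma> 1 1 4 q + \<gamma> 2 2 4 q"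
  proof (rule cancel)
    have e: "E 4 q a = a q * (\<gamma> 1 1 4 q + \<gamma> 2 2 4 q) + b q * (\<gamma> 1 2 3 q - \<gamma> 2 1 3 q)"
      "E 4 q b = b q * (\<gamma> 1 1 4 q + \<gamma> 2 2 4 q) + a q * (\<gamma> 1 2 3 q - \<gamma> 2 1 3 q)"
      using dh[of 1 2 4] ds(2) anti[of 1 1 4] anti[of 2 2 4]
      unfolding fd by (simp_all add: sum_4 frame_value_def 1 algebra_simps)
    show "E 4 q f * ((a q)\<^sup>2 - (b q)\<^sup>2) = (\<gamma> 1 1 4 q + \<gamma> 2 2 4 q) * ((a q)\<^sup>2 - (b q)\<^sup>2)"
      unfolding grad e by (simp add: algebra_simps power2_eq_square)
  qed
qed

text \<open>Antisymmetry at the single point \<open>p\<close> could not be differentiated; it holds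
  on the open set \<open>U\<close>, and a tangent vector is local.\<close>

lemma coefficient_deriv_antisym:
  assumes "p \<in> U"
  shows "E l p (\<gamma> i j k) = - E l p (\<gamma> i k j)"
proof -
  note n = smooth_nearI[OF coefficient_smooth assms]
  have "E l p (\<gamma> i j k) = E l p (\<lambda>q. - \<gamma> i k j q)"
    by (rule tangent_cong[OF frame_tangent[OF assms] n open_U assms]) (rule coefficient_antisym)
  then show ?thesis by (simp add: tangent_uminus[OF frame_tangent[OF assms] n])
qed

end

theorem mainTheorem2:
  fixes A :: "('m::{t2_space, second_countable_topology}, 4) atlas"
    and g h :: "'m bilin_field"
    and nabla :: "'m connection"
    and U :: "'m set" and x0 p :: 'm
    and E :: "4 \<Rightarrow> 'm vfield"
    and w :: "4 \<Rightarrow> 'm \<Rightarrow> 'm tangent \<Rightarrow> real"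
    and \<gamma> :: "4 \<Rightarrow> 4 \<Rightarrow> 4 \<Rightarrow> 'm \<Rightarrow> real"
    and a b f :: "'m \<Rightarrow> real"
  assumes "oriented_atlas A" and "riemannian_metric A g" and "levi_civita A g nabla"
    and "two_form A h" and "closed_form A h" and "coclosed_form A g h"
    and "\<not> self_dual_at A g h x0" and "\<not> anti_self_dual_at A g h x0"
    and "open U" and "x0 \<in> U"
    and "oriented_orthonormal_frame A g U E" and "dual_coframe A U E w"
    and "\<And>q u v. q \<in> U \<Longrightarrow> u \<in> tangent_space A q \<Longrightarrow> v \<in> tangent_space A q \<Longrightarrow>
           h q u v = a q * wedge (w 1 q) (w 2 q) u v + b q * wedge (w 3 q) (w 4 q) u v"
    and "\<And>q. q \<in> U \<Longrightarrow> a q > \<bar>b q\<bar>"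
    and "\<And>q. q \<in> U \<Longrightarrow> f q = ln (sqrt ((a q)\<^sup>2 - (b q)\<^sup>2))"
    and "connection_coefficients U nabla E \<gamma>"
    and "p \<in> U" and "critical_point A f p"
  shows "- laplacian A g nabla f p =
      sectional_curvature A g nabla (E 1) (E 3) p + sectional_curvature A g nabla (E 2) (E 3) p
    + sectional_curvature A g nabla (E 1) (E 4) p + sectional_curvature A g nabla (E 2) (E 4) p
    + bilin_norm_sq A g p (second_fundamental_form E w \<gamma> {1, 2} {3, 4} p)
    + bilin_norm_sq A g p (second_fundamental_form E w \<gamma> {3, 4} {1, 2} p)
    - 1/2 * tangent_norm_sq g p (torsion_vector E \<gamma> 1 2 {3, 4} p)
    - 1/2 * tangent_norm_sq g p (torsion_vector E \<gamma> 3 4 {1, 2} p)"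
proof -
  interpret levi_civita_frame4 A g nabla U E \<gamma>
    using assms by unfold_locales
  have w: "tangent_linear A q (w i q)" "w i q (E j q) = (if i = j then 1 else 0)" if "q \<in> U" for q i j
    using assms(12) that by (auto simp: dual_coframe_def)
  \<comment> \<open>For an orthonormal frame the dual coframe is the metric dual; this brings
    \<open>h\<close> into the shape \<open>coframe_form\<close>.\<close>
  have w_eq: "w i q u = g q u (E i q)" if "q \<in> U" "u \<in> tangent_space A q" for i q u
    using onb_linear[OF frame_onb[OF that(1)] that(2) w(1)[OF that(1)], of i]
    by (simp add: w(2)[OF that(1)] if_distrib[of "\<lambda>x. _ * x"] cong: if_cong)
  have h: "\<forall>q\<in>U. \<forall>u\<in>tangent_space A q. \<forall>v\<in>tangent_space A q. h q u v = coframe_form a b q u v"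
    using assms(13) by (simp add: wedge_def coframe_form_def w_eq)
  have ab: "\<forall>q\<in>U. \<bar>b q\<bar> < a q" and f: "\<forall>q\<in>U. f q = ln (sqrt ((a q)\<^sup>2 - (b q)\<^sup>2))"
    using assms(14,15) by blast+
  note p = \<open>p \<in> U\<close>
  have "smooth_bilin_field A h" using assms(4) by (simp add: two_form_def)
  note grad = harmonic_form_gradient[OF this assms(5,6) h ab f]
  have Ef: "E i p f = 0" for i
    using assms(18) frame_tangent[OF p] unfolding critical_point_def by blast
  note n = smooth_nearI[OF coefficient_smooth p]
  note T = frame_tangent[OF p]
  \<comment> \<open>The gradient formula holds on all of \<open>U\<close>, so it may be
    differentiated once more, although both of its sides vanish at \<open>p\<close>.\<close>
  have E2: "E i p (\<lambda>q. E i q f) = E i p (\<gamma> j j i) + E i p (\<gamma> k k i)"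
    if "\<And>q. q \<in> U \<Longrightarrow> E i q f = \<gamma> j j i q + \<gamma> k k i q" for i j k
  proof -
    have "E i p (\<lambda>q. E i q f) = E i p (\<lambda>q. \<gamma> j j i q + \<gamma> k k i q)"
      by (rule tangent_cong[OF T _ open_U p that[symmetric], symmetric]) (intro smooth_near_add n)
    then show ?thesis by (simp add: tangent_add[OF T n n])
  qed
  have lap: "- laplacian A g nabla f p = E 1 p (\<gamma> 3 3 1) + E 1 p (\<gamma> 4 4 1) + E 2 p (\<gamma> 3 3 2) + E 2 p (\<gamma> 4 4 2)
      + E 3 p (\<gamma> 1 1 3) + E 3 p (\<gamma> 2 2 3) + E 4 p (\<gamma> 1 1 4) + E 4 p (\<gamma> 2 2 4)"
    unfolding laplacian_critical[OF p grad(1) assms(18)]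
    by (simp add: sum_4 E2[OF grad(2)] E2[OF grad(3)] E2[OF grad(4)] E2[OF grad(5)])
  have anti: "\<gamma> i j j p = 0" for i j
    using coefficient_antisym[OF p, of i j j] by simp
  \<comment> \<open>Oriented so that the larger of the last two indices comes first. This gives the
    coefficients at \<open>p\<close> a normal form, to which the relations in \<open>H\<close>
    (vanishing mean curvatures) are adapted.\<close>
  have anti': "\<gamma> i 1 2 p = - \<gamma> i 2 1 p" "\<gamma> i 1 3 p = - \<gamma> i 3 1 p" "\<gamma> i 1 4 p = - \<gamma> i 4 1 p"
    "\<gamma> i 2 3 p = - \<gamma> i 3 2 p" "\<gamma> i 2 4 p = - \<gamma> i 4 2 p" "\<gamma> i 3 4 p = - \<gamma> i 4 3 p" for i
    by (rule coefficient_antisym[OF p])+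
  have H: "\<gamma> 4 4 1 p = - \<gamma> 3 3 1 p" "\<gamma> 4 4 2 p = - \<gamma> 3 3 2 p"
    "\<gamma> 2 3 2 p = - \<gamma> 1 3 1 p" "\<gamma> 2 4 2 p = - \<gamma> 1 4 1 p"
    using grad(2-5)[OF p] Ef by (simp_all add: anti')
  note dual = second_fundamental_form_norm[where E = E and w = w and \<gamma> = \<gamma>,
      OF frame_onb[OF p] w(1)[OF p] w(2)[OF p]]
  note torsion = tangent_norm_sq_def torsion_vector_def onb_metric_sums[OF frame_onb[OF p]]
  note deriv = coefficient_deriv_antisym[OF p, of 3 1 3 1] coefficient_deriv_antisym[OF p, of 3 2 3 2]
    coefficient_deriv_antisym[OF p, of 4 1 4 1] coefficient_deriv_antisym[OF p, of 4 2 4 2]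
  \<comment> \<open>For i in {1,2} and j in {3,4}, the products
    \<open>\<gamma> j j m * \<gamma> i m i\<close> sum to 0 by \<open>H\<close>, and the products
    with a coefficient whose last two indices lie in the same pair cancel. There remains minus the
    sum of all \<open>\<gamma> i j m * \<gamma> j i m\<close>, with i, j in one pair and m in the
    other, which is compensated by the second fundamental forms and the torsion.\<close>
  show ?thesis
    unfolding lap dual torsion
    by (simp add: sectional_curvature_frame[OF p] sum_4 anti anti' H deriv power2_eq_square field_simps)
qed

end
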